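(* Let $\mathcal{P}=(p_1,p_2,\dots)$ be a probability distribution on $\mathbb{N}$ with $p_1\ge p_2\ge\cdots$ and unbounded support, and consider the recurrent Binary Flipping (BF) model in discrete time with distribution $\mathcal{P}$ and return time $\tau_{\mathrm{BF}}$, where $p_k\sim C_1p^k$ as $k\to\infty$ for some fixed constant $C_1>0$ and $p\in(0,1/2)$. Then: (i) $\mathbf{E}\,\tau_{\mathrm{BF}}^r<\infty$ for any positive $r<1-\frac{\log 2}{\log(1/p)}$. Moreover, for any such $r$, if the Markov chain $\{\zeta_n\}$ is started from an arbitrary $\zeta_0$ with the largest active bit $M_0$, then there exists a constant $C_2=C_2(C_1,p,r)$, depending only on $C_1$, $p$ and $r$, such that $$\mathbf{E}\left[\tau_{\mathrm{BF}}^r\mid M_0=m\right]\le C_2\left(\frac{1}{2p}\right)^m .$$ (ii) $\mathbf{E}\,\tau_{\mathrm{BF}}^r=\infty$ for any $r>1-\frac{\log(2-p)}{\log(1/p)}$.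
   Context: $\mathbb{N}=\{1,2,\dots\}$; $a_k\sim b_k$ means $a_k/b_k\to1$ as $k\to\infty$. Binary Flipping (BF) model: let $\chi_1,\chi_2,\dots$ be i.i.d. random variables with $\mathbf{P}(\chi_i=k)=p_k$, $k\in\mathbb{N}$, independent of the initial state $\zeta_0$. The BF model is the discrete-time Markov chain $\zeta_n=(\zeta_n^1,\zeta_n^2,\dots)$, $n\ge 0$, with values in $\mathcal{X}=\{x\in\{0,1\}^{\mathbb{N}}: x\text{ has finitely many non-zeros}\}$, with $$\zeta^k_{n+1}=\begin{cases}\zeta^k_n,& k\ne\chi_{n+1},\\ 1-\zeta^k_n,& k=\chi_{n+1},\end{cases}\qquad k\in\mathbb{N},\ n\ge 0.$$ Unless another initial state is specified, the chain starts from the ground state $\zeta_0=\mathbf{0}=(0,0,\dots)$. Bit $k$ is active at step $n$ if $\zeta_n^k=1$. The largest active bit of $\zeta_0$ is $M_0=\max\{k:\zeta_0^k=1\}$, with $M_0=0$ if $\zeta_0=\mathbf{0}$. The return time is $\tau_{\mathrm{BF}}=\min\{n\ge 1:\zeta_n=\mathbf{0}\}$, with $\tau_{\mathrm{BF}}=\infty$ if no such $n$ exists. The model is recurrent if, started from the ground state, $\mathbf{P}(\tau_{\mathrm{BF}}<\infty)=1$.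
   Formalization: The constant C_2 is allowed to depend on the whole distribution P and r (uniformly in m and the initial state), not only on C_1, p and r, since uniformity over all P with the same C_1, p is false; the chains it serves live on probability spaces over one arbitrary type. *)

theory Defs
  imports "HOL-Probability.Probability"
begin

text \<open>
  A state is the sequence of its bits, with values in {0, 1}. Bits are numbered from 1; coordinate 0
  is not a bit and is pinned to 0, so that states are equal iff all their bits agree.
\<close>

type_synonym bf_state = "nat \<Rightarrow> nat"

definition bf_states :: "bf_state set" where
  "bf_states = {x. x 0 = 0 \<and> (\<forall>k. x k \<in> {0, 1}) \<and> finite {k. x k \<noteq> 0}}"

definition ground :: bf_state where
  "ground = (\<lambda>_. 0)"

definition largest_active :: "bf_state \<Rightarrow> nat" where
  "largest_active x = (if x = ground then 0 else Max {k. x k = 1})"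

text \<open>
  Driving data of a BF chain: the initial state \<open>\<zeta>0\<close> and, independent of it, the i.i.d. sequence
  \<open>\<xi> 1, \<xi> 2, \<dots>\<close> with distribution \<open>P\<close> (the value \<open>\<xi> 0\<close> plays no role). The set of states is
  countable, so it carries the discrete sigma-algebra.
\<close>

locale bf_model = prob_space M
  for M :: "'a measure" and P :: "nat pmf"
    and \<xi> :: "nat \<Rightarrow> 'a \<Rightarrow> nat" and \<zeta>0 :: "'a \<Rightarrow> bf_state" +
  assumes indep_\<xi>: "indep_vars (\<lambda>_. count_space UNIV) \<xi> {1..}"
    and distr_\<xi>: "\<And>i k. i \<ge> 1 \<Longrightarrow> prob {\<omega> \<in> space M. \<xi> i \<omega> = k} = pmf P k"
    and indep_init: "indep_var (count_space bf_states) \<zeta>0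
      (PiM {1..} (\<lambda>_. count_space UNIV)) (\<lambda>\<omega>. \<lambda>i\<in>{1..}. \<xi> i \<omega>)"

primrec bf_chain :: "(nat \<Rightarrow> 'a \<Rightarrow> nat) \<Rightarrow> ('a \<Rightarrow> bf_state) \<Rightarrow> nat \<Rightarrow> 'a \<Rightarrow> bf_state" where
  "bf_chain \<xi> \<zeta>0 0 \<omega> = \<zeta>0 \<omega>"
| "bf_chain \<xi> \<zeta>0 (Suc n) \<omega> = (\<lambda>k. if k = \<xi> (Suc n) \<omega>
     then 1 - bf_chain \<xi> \<zeta>0 n \<omega> k else bf_chain \<xi> \<zeta>0 n \<omega> k)"

definition bf_return_time :: "(nat \<Rightarrow> 'a \<Rightarrow> nat) \<Rightarrow> ('a \<Rightarrow> bf_state) \<Rightarrow> 'a \<Rightarrow> enat" where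
  "bf_return_time \<xi> \<zeta>0 \<omega> =
     (if \<exists>n\<ge>1. bf_chain \<xi> \<zeta>0 n \<omega> = ground
      then enat (LEAST n. n \<ge> 1 \<and> bf_chain \<xi> \<zeta>0 n \<omega> = ground) else \<infinity>)"

text \<open>Only meant for exponents \<open>r > 0\<close>, for which infinity to the power \<open>r\<close> is infinity.\<close>

definition enat_powr :: "enat \<Rightarrow> real \<Rightarrow> ennreal" where
  "enat_powr t r = (case t of enat n \<Rightarrow> ennreal (real n powr r) | \<infinity> \<Rightarrow> \<infinity>)"

definition bf_moment ::
    "'a measure \<Rightarrow> (nat \<Rightarrow> 'a \<Rightarrow> nat) \<Rightarrow> ('a \<Rightarrow> bf_state) \<Rightarrow> real \<Rightarrow> ennreal" where
  "bf_moment M \<xi> \<zeta>0 r = (\<integral>\<^sup>+ \<omega>. enat_powr (bf_return_time \<xi> \<zeta>0 \<omega>) r \<partial>M)"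

text \<open>The event that the largest active bit of the initial state is \<open>m\<close>. Conditioning on it means passing to
  the \<open>uniform_measure\<close> of this event.\<close>

definition bf_init_event :: "'a measure \<Rightarrow> ('a \<Rightarrow> bf_state) \<Rightarrow> nat \<Rightarrow> 'a set" where
  "bf_init_event M \<zeta>0 m = {\<omega> \<in> space M. largest_active (\<zeta>0 \<omega>) = m}"

definition bf_recurrent :: "'a measure \<Rightarrow> (nat \<Rightarrow> 'a \<Rightarrow> nat) \<Rightarrow> bool" where
  "bf_recurrent M \<xi> \<longleftrightarrow>
     measure M {\<omega> \<in> space M. bf_return_time \<xi> (\<lambda>_. ground) \<omega> < \<infinity>} = 1"

end

theory Submission
  imports Defs
begin

text \<open>
  The chain is a random walk on the group of finitely supported 0/1 sequences, and the characters
  of this group diagonalise it. An infinite sequence \<open>a\<close> of fair coins selects a random set of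
  bits; the state \<open>x\<close> has the character \<open>(-1)^n\<close>, where \<open>n\<close> is the number of selected active
  bits, and one step of the walk multiplies it by \<open>1 - 2 h\<close>, where \<open>h\<close> is the mass that \<open>P\<close> gives to
  the selected set (\<open>hit_mass\<close>). Hence the Green function, the generating function of the transition
  probabilities from \<open>x\<close> to the ground state, is the expectation over the coins
  \<open>G\<^sub>s(x) = E [character / (1 - s + 2 s h)]\<close>. No transition probability is ever computed: the lemma
  \<open>green_step\<close> shows that \<open>G\<^sub>s\<close> solves the right linear equation, and \<open>survival_gf_bounds\<close> deduces
  that the probabilities \<open>survival P n x\<close> of no visit to the ground state in the steps \<open>1, ..., n\<close>
  have the generating function
  \<open>(G\<^sub>s(ground) - G\<^sub>s(x) + [x = ground]) / ((1 - s) G\<^sub>s(ground))\<close>, the resolvent.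

  The size of \<open>h\<close> is governed by the first selected bit, which is \<open>k\<close> with probability \<open>2^-k\<close> and
  then contributes \<open>p\<^sub>k\<close>, of order \<open>p^k\<close>. At the time scale \<open>1 / (1 - s) = p^-K\<close> this gives
  \<open>G\<^sub>s(ground)\<close> of order \<open>(2p)^-K\<close> (\<open>green_ground_lower\<close>, \<open>green_ground_upper\<close>). If the active bits
  of \<open>x\<close> are at most \<open>m\<close>, then \<open>x\<close> and the ground state have the same character unless one of the
  bits \<open>1, ..., m\<close> is selected, so \<open>G\<^sub>s(ground) - G\<^sub>s(x)\<close> is at most of order \<open>(2p)^-m\<close>, uniformly in
  \<open>s\<close> (\<open>green_difference_le\<close>). Together, the return time exceeds \<open>p^-K\<close> with probability at most of
  order \<open>(2p)^K (2p)^-m\<close> (\<open>survival_scale_time_le\<close>).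

  Summed over the scales, the moment of order \<open>r\<close> is at most \<open>(2p)^-m\<close> times a geometric series of
  ratio \<open>2p (1/p)^r\<close>, and this ratio is below 1 exactly when \<open>r < 1 - ln 2 / ln (1/p)\<close>. Conversely,
  a finite moment of order \<open>r \<le> 1\<close> keeps the resolvent of the ground state below a multiple of
  \<open>(1 - s)^(r - 1)\<close> (\<open>powr_le_green_of_finite_moment\<close>), whereas at scale \<open>K\<close> it is of order
  \<open>p^-K (2p)^K\<close>; this is contradictory when the same ratio exceeds 1. The divergence therefore
  begins at the exponent at which the convergence ends, and \<open>ln (2 - p) < ln 2\<close> places the second
  claim in this range.
\<close>

section \<open>Characters of the group of states\<close>

definition flip :: "nat \<Rightarrow> bf_state \<Rightarrow> bf_state" where
  "flip k x = (\<lambda>j. if j = k then 1 - x j else x j)"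

text \<open>The set \<open>bf_states\<close> without the condition at the coordinate 0, so that it is closed under every
  flip, the flip of coordinate 0 included.\<close>

definition bits :: "bf_state set" where
  "bits = {x. (\<forall>k. x k \<in> {0, 1}) \<and> finite {k. x k \<noteq> 0}}"

lemma ground_bits [simp]: "ground \<in> bits"
  by (simp add: bits_def ground_def)

lemma finite_support_bits: "x \<in> bits \<Longrightarrow> finite {k. x k \<noteq> 0}"
  by (simp add: bits_def)

lemma support_flip:
  assumes "x \<in> bits"
  shows "{j. flip k x j \<noteq> 0} =
    (if x k = 0 then insert k {j. x j \<noteq> 0} else {j. x j \<noteq> 0} - {k})"
  using assms by (auto simp: flip_def bits_def)

lemma flip_bits [simp]: "x \<in> bits \<Longrightarrow> flip k x \<in> bits"
  using support_flip[of x k] unfolding bits_def by (auto simp: flip_def)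

definition bit_sign :: "bool \<Rightarrow> real" where
  "bit_sign b = (if b then -1 else 1)"

text \<open>For fixed \<open>a\<close> this is a homomorphism from the group of states, with addition modulo 2, to the
  signs, and every such homomorphism has this form.\<close>

definition character :: "bf_state \<Rightarrow> (nat \<Rightarrow> bool) \<Rightarrow> real" where
  "character x a = (\<Prod>k | x k \<noteq> 0. bit_sign (a k))"

lemma bit_sign_square: "bit_sign b * bit_sign b = 1"
  by (simp add: bit_sign_def)

lemma character_ground [simp]: "character ground a = 1"
  by (simp add: character_def ground_def)

lemma abs_character [simp]: "\<bar>character x a\<bar> = 1"
  unfolding character_def abs_prod by (simp add: bit_sign_def if_distrib cong: if_cong)

lemma character_flip:
  assumes "x \<in> bits"
  shows "character (flip k x) a = bit_sign (a k) * character x a"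
proof (cases "x k = 0")
  case True
  then show ?thesis
    unfolding character_def support_flip[OF assms]
    using finite_support_bits[OF assms] by simp
next
  case False
  then have "character x a = bit_sign (a k) * character (flip k x) a"
    unfolding character_def support_flip[OF assms]
    using finite_support_bits[OF assms] by (simp add: prod.remove[where x = k])
  then show ?thesis
    by (simp add: mult.assoc[symmetric] bit_sign_square)
qed

definition coins :: "(nat \<Rightarrow> bool) measure" where
  "coins = (\<Pi>\<^sub>M k\<in>UNIV. measure_pmf (bernoulli_pmf (1/2)))"

interpretation coin_factors: product_prob_space "\<lambda>k::nat. measure_pmf (bernoulli_pmf (1/2))" UNIV
  by (intro product_prob_spaceI measure_pmf.prob_space_axioms)

interpretation coins: prob_space coins
  unfolding coins_def by (intro prob_space_PiM measure_pmf.prob_space_axioms)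

lemma space_coins [simp]: "space coins = UNIV"
  by (auto simp: coins_def space_PiM)

lemma coin_measurable [measurable]: "(\<lambda>a. a k) \<in> measurable coins (count_space UNIV)"
proof -
  have "(\<lambda>a. a k) \<in> measurable coins (measure_pmf (bernoulli_pmf (1/2)))"
    unfolding coins_def by measurable
  then show ?thesis by (simp add: measurable_def)
qed

lemma coin_measurable_pair [measurable]:
  "(\<lambda>(k, a). a k) \<in> measurable (count_space UNIV \<Otimes>\<^sub>M coins) (count_space UNIV)"
  by (rule measurable_pair_measure_countable1) auto

text \<open>The size of the Green function will be read off from which of the bits \<open>1, ..., K\<close> is selected
  first; these events are cylinders.\<close>

lemma coins_cylinder:
  assumes "finite J"
  shows "measure coins {a. \<forall>k\<in>J. a k = b k} = (1/2) ^ card J"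
proof -
  have "emeasure coins {a. \<forall>k\<in>J. a k \<in> {b k}}
      = (\<Prod>k\<in>J. emeasure (measure_pmf (bernoulli_pmf (1/2))) {b k})"
    using coin_factors.emeasure_PiM_Collect[of J "\<lambda>k. {b k}"] assms
    by (simp add: coins_def[symmetric])
  also have "\<dots> = (\<Prod>k\<in>J. ennreal (1/2))"
    by (intro prod.cong refl) (simp add: emeasure_pmf_single pmf_bernoulli_half)
  also have "\<dots> = ennreal ((1/2) ^ card J)"
    unfolding prod_constant by (rule ennreal_power) simp
  finally show ?thesis
    by (simp add: measure_def)
qed

lemma character_measurable [measurable]: "character x \<in> borel_measurable coins"
  unfolding character_def bit_sign_def by measurable

text \<open>Orthogonality of the characters: a nontrivial product of independent fair signs has mean 0. This
  is the transition probability in 0 steps, and it makes the ground state the source term of the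
  Green function.\<close>

lemma expectation_character:
  assumes x: "x \<in> bits"
  shows "(\<integral>a. character x a \<partial>coins) = of_bool (x = ground)"
proof (cases "x = ground")
  case True
  then show ?thesis by (simp add: coins.prob_space[simplified])
next
  case False
  let ?B = "measure_pmf (bernoulli_pmf (1/2))"
  define J where "J = {k. x k \<noteq> 0}"
  have J: "finite J" "J \<noteq> {}"
    using finite_support_bits[OF x] False by (auto simp: J_def ground_def)
  have "(\<integral>a. character x a \<partial>coins) = (\<integral>a. (\<Prod>k\<in>J. bit_sign (restrict a J k)) \<partial>coins)"
    by (simp add: character_def J_def)
  also have "\<dots> = (\<integral>a. (\<Prod>k\<in>J. bit_sign (a k)) \<partial>distr coins (\<Pi>\<^sub>M k\<in>J. ?B) (\<lambda>a. restrict a J))"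
  proof (rule integral_distr[symmetric])
    show "(\<lambda>a. restrict a J) \<in> measurable coins (\<Pi>\<^sub>M k\<in>J. ?B)"
      unfolding coins_def by (rule measurable_restrict_subset) simp
    have "(\<lambda>a. bit_sign (a k)) \<in> borel_measurable (\<Pi>\<^sub>M k\<in>J. ?B)" if "k \<in> J" for k
      by (rule measurable_compose[OF measurable_component_singleton[OF that]]) simp
    then show "(\<lambda>a. \<Prod>k\<in>J. bit_sign (a k)) \<in> borel_measurable (\<Pi>\<^sub>M k\<in>J. ?B)"
      by (rule borel_measurable_prod)
  qed
  also have "\<dots> = (\<integral>a. (\<Prod>k\<in>J. bit_sign (a k)) \<partial>(\<Pi>\<^sub>M k\<in>J. ?B))"
    using coin_factors.distr_PiM_restrict_finite[of J] J by (simp add: coins_def)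
  also have "\<dots> = (\<Prod>k\<in>J. \<integral>b. bit_sign b \<partial>?B)"
    using J by (intro coin_factors.product_integral_prod)
       (auto intro!: measure_pmf.integrable_const_bound[where B = 1] simp: bit_sign_def)
  also have "(\<integral>b. bit_sign b \<partial>?B) = 0"
    by (simp add: bit_sign_def)
  finally show ?thesis
    using J False by (simp add: card_gt_0_iff)
qed

section \<open>The Green function\<close>

definition hit_mass :: "nat pmf \<Rightarrow> (nat \<Rightarrow> bool) \<Rightarrow> real" where
  "hit_mass P a = measure_pmf.prob P {k. a k}"

lemma hit_mass_nonneg [simp]: "0 \<le> hit_mass P a"
  and hit_mass_le_1 [simp]: "hit_mass P a \<le> 1"
  by (simp_all add: hit_mass_def)

text \<open>The eigenvalue of the walk at the character given by \<open>a\<close>.\<close>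

lemma expectation_bit_sign: "(\<integral>k. bit_sign (a k) \<partial>measure_pmf P) = 1 - 2 * hit_mass P a"
proof -
  have "(\<integral>k. bit_sign (a k) \<partial>measure_pmf P) = (\<integral>k. 1 - 2 * indicator {k. a k} k \<partial>measure_pmf P)"
    by (intro Bochner_Integration.integral_cong) (auto simp: bit_sign_def)
  also have "\<dots> = 1 - 2 * hit_mass P a"
    using measure_pmf.integrable_const_bound[where f="indicator {k. a k} :: nat \<Rightarrow> real" and B=1]
    by (simp add: hit_mass_def)
  finally show ?thesis .
qed

lemma sets_pair_pmf_coins:
  "sets (measure_pmf P \<Otimes>\<^sub>M coins) = sets (count_space UNIV \<Otimes>\<^sub>M coins)"
  by (intro sets_pair_measure_cong) simp_all

lemma bit_sign_pair_measurable [measurable]: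
  "(\<lambda>(k, a). bit_sign (a k)) \<in> borel_measurable (measure_pmf P \<Otimes>\<^sub>M coins)"
proof -
  have "(\<lambda>(k, a). bit_sign (a k)) \<in> borel_measurable (count_space UNIV \<Otimes>\<^sub>M coins)"
    unfolding split_beta'
    by (rule measurable_compose[OF coin_measurable_pair[unfolded split_beta'], where g = bit_sign]) simp
  then show ?thesis
    by (simp add: measurable_cong_sets[OF sets_pair_pmf_coins refl])
qed

interpretation pmf_coins: pair_prob_space "measure_pmf P" coins for P :: "nat pmf" ..

lemma hit_mass_measurable [measurable]: "hit_mass P \<in> borel_measurable coins"
proof -
  have "(\<lambda>a. \<integral>k. bit_sign (a k) \<partial>measure_pmf P) \<in> borel_measurable coins"
    by (rule measure_pmf.borel_measurable_lebesgue_integral)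
       (use measurable_compose[OF measurable_pair_swap' bit_sign_pair_measurable[of P]]
        in \<open>simp add: split_beta' comp_def\<close>)
  then have "(\<lambda>a. (1 - (\<integral>k. bit_sign (a k) \<partial>measure_pmf P)) / 2) \<in> borel_measurable coins"
    by measurable
  then show ?thesis by (simp add: expectation_bit_sign)
qed

text \<open>The sum over \<open>n\<close> of the powers \<open>(s (1 - 2 h))^n\<close>, with \<open>h\<close> the hit mass.\<close>

definition weight :: "nat pmf \<Rightarrow> real \<Rightarrow> (nat \<Rightarrow> bool) \<Rightarrow> real" where
  "weight P s a = 1 / (1 - s + 2 * s * hit_mass P a)"

definition green :: "nat pmf \<Rightarrow> real \<Rightarrow> bf_state \<Rightarrow> real" where
  "green P s x = (\<integral>a. character x a * weight P s a \<partial>coins)"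

lemma weight_measurable [measurable]: "weight P s \<in> borel_measurable coins"
  unfolding weight_def by measurable

lemma weight_bounds:
  assumes "0 < s" "s < 1"
  shows "0 < weight P s a" "weight P s a \<le> 1 / (1 - s)"
proof -
  have "0 \<le> 2 * s * hit_mass P a" using assms by simp
  then show "0 < weight P s a" "weight P s a \<le> 1 / (1 - s)"
    using assms unfolding weight_def by (auto intro!: frac_le divide_pos_pos add_pos_nonneg)
qed

lemma weight_integrable:
  assumes "0 < s" "s < 1"
  shows "integrable coins (\<lambda>a. weight P s a)"
    and "integrable coins (\<lambda>a. character x a * weight P s a)"
  using weight_bounds[OF assms, of P]
  by (auto intro!: coins.integrable_const_bound[where B = "1 / (1 - s)"] simp: abs_mult less_imp_le)

text \<open>The defining equation of the Green function. It holds coin sequence by coin sequence, because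
  flipping bit \<open>k\<close> multiplies the character by the sign of coin \<open>k\<close>; averaging over \<open>k\<close> produces
  the eigenvalue, and \<open>weight P s a\<close> inverts 1 minus \<open>s\<close> times it.\<close>

lemma green_step:
  assumes s: "0 < s" "s < 1" and x: "x \<in> bits"
  shows "green P s x = of_bool (x = ground) + s * (\<integral>k. green P s (flip k x) \<partial>measure_pmf P)"
proof -
  have bnd: "\<bar>weight P s a\<bar> \<le> 1 / (1 - s)" for a
    using weight_bounds[OF s, of P a] by simp
  have "(\<integral>k. green P s (flip k x) \<partial>measure_pmf P)
      = (\<integral>k. (\<integral>a. bit_sign (a k) * (character x a * weight P s a) \<partial>coins) \<partial>measure_pmf P)"
    by (simp add: green_def character_flip[OF x] mult.assoc)
  also have "\<dots> = (\<integral>a. (\<integral>k. bit_sign (a k) * (character x a * weight P s a) \<partial>measure_pmf P) \<partial>coins)"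
  proof (rule pmf_coins.Fubini_integral[symmetric])
    show "integrable (measure_pmf P \<Otimes>\<^sub>M coins) (\<lambda>(k, a). bit_sign (a k) * (character x a * weight P s a))"
    proof (rule pmf_coins.P.integrable_const_bound[where B = "1 / (1 - s)"])
      show "AE z in measure_pmf P \<Otimes>\<^sub>M coins.
          norm (case z of (k, a) \<Rightarrow> bit_sign (a k) * (character x a * weight P s a)) \<le> 1 / (1 - s)"
        using bnd by (auto simp: abs_mult bit_sign_def)
      show "(\<lambda>(k, a). bit_sign (a k) * (character x a * weight P s a))
          \<in> borel_measurable (measure_pmf P \<Otimes>\<^sub>M coins)"
        using bit_sign_pair_measurable[of P] unfolding split_beta' by measurable
    qed
  qed
  also have "\<dots> = (\<integral>a. (1 - 2 * hit_mass P a) * (character x a * weight P s a) \<partial>coins)"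
    by (simp add: expectation_bit_sign)
  finally have swap: "(\<integral>k. green P s (flip k x) \<partial>measure_pmf P) = \<dots>" .
  have *: "character x a * weight P s a
      = character x a + s * ((1 - 2 * hit_mass P a) * (character x a * weight P s a))" for a
  proof -
    have "0 \<le> 2 * s * hit_mass P a" using s by simp
    then have "1 - s + 2 * s * hit_mass P a \<noteq> 0" using s by linarith
    then show ?thesis by (simp add: weight_def field_simps)
  qed
  have int: "integrable coins (\<lambda>a. (1 - 2 * hit_mass P a) * (character x a * weight P s a))"
  proof (rule coins.integrable_const_bound[where B = "1 / (1 - s)"])
    have "\<bar>1 - 2 * hit_mass P a\<bar> \<le> 1" for a
      using hit_mass_nonneg[of P a] hit_mass_le_1[of P a] by linarith
    then have "\<bar>1 - 2 * hit_mass P a\<bar> * \<bar>weight P s a\<bar> \<le> 1 * (1 / (1 - s))" for a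
      using bnd by (intro mult_mono) auto
    then show "AE a in coins. norm ((1 - 2 * hit_mass P a) * (character x a * weight P s a)) \<le> 1 / (1 - s)"
      by (simp add: abs_mult)
  qed measurable
  have "green P s x = (\<integral>a. character x a
      + s * ((1 - 2 * hit_mass P a) * (character x a * weight P s a)) \<partial>coins)"
    unfolding green_def by (rule Bochner_Integration.integral_cong[OF refl *])
  also have "\<dots> = (\<integral>a. character x a \<partial>coins)
      + (\<integral>a. s * ((1 - 2 * hit_mass P a) * (character x a * weight P s a)) \<partial>coins)"
    using int by (intro Bochner_Integration.integral_add)
      (auto intro!: coins.integrable_const_bound[where B = 1])
  finally show ?thesis
    by (simp add: swap expectation_character[OF x])
qed

section \<open>Survival probabilities and the resolvent\<close>

primrec avoids_ground :: "bf_state \<Rightarrow> nat list \<Rightarrow> bool" where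
  "avoids_ground x [] \<longleftrightarrow> True"
| "avoids_ground x (k # l) \<longleftrightarrow> flip k x \<noteq> ground \<and> avoids_ground (flip k x) l"

text \<open>The probability that the walk from \<open>x\<close> does not visit the ground state in the steps
  \<open>1, ..., n\<close>; the starting point itself does not count.\<close>

definition survival :: "nat pmf \<Rightarrow> nat \<Rightarrow> bf_state \<Rightarrow> real" where
  "survival P n x = measure_pmf.prob (replicate_pmf n P) {l. avoids_ground x l}"

lemma survival_0 [simp]: "survival P 0 x = 1"
  by (simp add: survival_def)

lemma survival_nonneg [simp]: "0 \<le> survival P n x"
  and survival_le_1 [simp]: "survival P n x \<le> 1"
  by (simp_all add: survival_def)

lemma integrable_pmf_bounded:
  fixes f :: "nat \<Rightarrow> real"
  assumes "\<And>k. \<bar>f k\<bar> \<le> B"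
  shows "integrable (measure_pmf P) f"
  using assms by (intro measure_pmf.integrable_const_bound[where B = B]) auto

lemma survival_Suc:
  "survival P (Suc n) x =
    (\<integral>k. (if flip k x = ground then 0 else survival P n (flip k x)) \<partial>measure_pmf P)"
proof -
  let ?g = "\<lambda>k. if flip k x = ground then 0 else survival P n (flip k x)"
  have inner: "(\<integral>\<^sup>+l. indicator {l. avoids_ground x l} (k # l) \<partial>measure_pmf (replicate_pmf n P))
      = ennreal (?g k)" for k
  proof -
    have "(\<integral>\<^sup>+l. indicator {l. avoids_ground x l} (k # l) \<partial>measure_pmf (replicate_pmf n P))
        = (\<integral>\<^sup>+l. indicator (if flip k x = ground then {} else {l. avoids_ground (flip k x) l}) l
            \<partial>measure_pmf (replicate_pmf n P))"
      by (intro nn_integral_cong) (auto simp: indicator_def)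
    then show ?thesis
      by (simp add: survival_def measure_pmf.emeasure_eq_measure)
  qed
  have "emeasure (measure_pmf (replicate_pmf (Suc n) P)) {l. avoids_ground x l}
      = (\<integral>\<^sup>+k. ennreal (?g k) \<partial>measure_pmf P)"
    by (simp add: inner)
  then have "ennreal (survival P (Suc n) x) = (\<integral>\<^sup>+k. ennreal (?g k) \<partial>measure_pmf P)"
    unfolding survival_def[of P "Suc n" x] measure_pmf.emeasure_eq_measure .
  also have "\<dots> = ennreal (\<integral>k. ?g k \<partial>measure_pmf P)"
    by (intro nn_integral_eq_integral integrable_pmf_bounded[where B = 1]) auto
  finally show ?thesis
    by (subst (asm) ennreal_inj) (auto intro!: integral_nonneg_AE)
qed

lemma survival_Suc_le: "survival P (Suc n) x \<le> survival P n x"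
proof (induction n arbitrary: x)
  case 0
  then show ?case by simp
next
  case (Suc n)
  show ?case
    unfolding survival_Suc[of P "Suc n" x] survival_Suc[of P n x]
    by (intro integral_mono integrable_pmf_bounded[where B = 1]) (auto simp: Suc)
qed

lemma survival_antimono: "m \<le> n \<Longrightarrow> survival P n x \<le> survival P m x"
  by (rule lift_Suc_antimono_le[of "\<lambda>n. survival P n x"]) (auto simp: survival_Suc_le)

lemma green_ground: "green P s ground = (\<integral>a. weight P s a \<partial>coins)"
  by (simp add: green_def)

text \<open>The character has modulus 1 and is constantly 1 at the ground state.\<close>

lemma abs_green_le:
  assumes "0 < s" "s < 1"
  shows "\<bar>green P s x\<bar> \<le> green P s ground"
proof -
  have "\<bar>green P s x\<bar> \<le> (\<integral>a. \<bar>character x a * weight P s a\<bar> \<partial>coins)"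
    unfolding green_def by (rule integral_abs_bound)
  also have "\<dots> = green P s ground"
    using weight_bounds(1)[OF assms, of P] by (simp add: green_ground abs_mult less_imp_le)
  finally show ?thesis .
qed

lemma green_ground_ge_half:
  assumes "0 < s" "s < 1"
  shows "1 / 2 \<le> green P s ground"
proof -
  have "1 / 2 \<le> weight P s a" for a
  proof -
    have "2 * s * hit_mass P a \<le> 2 * s * 1" "0 \<le> 2 * s * hit_mass P a"
      using assms by (auto intro!: mult_left_mono)
    then have "1 / 2 \<le> 1 / (1 - s + 2 * s * hit_mass P a)"
      using assms by (intro frac_le) linarith+
    then show ?thesis by (simp add: weight_def)
  qed
  then have "(\<integral>a. 1 / 2 \<partial>coins) \<le> green P s ground"
    unfolding green_ground by (intro integral_mono weight_integrable assms) auto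
  then show ?thesis by (simp add: coins.prob_space[simplified])
qed

text \<open>The generating function of the survival probabilities, as obtained formally by decomposing at
  the last visit to the ground state.\<close>

definition resolvent :: "nat pmf \<Rightarrow> real \<Rightarrow> bf_state \<Rightarrow> real" where
  "resolvent P s x = (green P s ground - green P s x + of_bool (x = ground)) / ((1 - s) * green P s ground)"

lemma resolvent_bounds:
  assumes s: "0 < s" "s < 1"
  shows "0 \<le> resolvent P s x" "resolvent P s x \<le> 2 / (1 - s)"
proof -
  have G: "1 / 2 \<le> green P s ground" "\<bar>green P s x\<bar> \<le> green P s ground"
    using green_ground_ge_half[OF s] abs_green_le[OF s] by auto
  let ?n = "green P s ground - green P s x + of_bool (x = ground)"
  have n: "0 \<le> ?n" "?n \<le> 2 * green P s ground"
    using G by (auto simp: abs_le_iff)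
  show "0 \<le> resolvent P s x"
    unfolding resolvent_def using n G s by (intro divide_nonneg_nonneg mult_nonneg_nonneg) auto
  have "resolvent P s x \<le> 2 * green P s ground / ((1 - s) * green P s ground)"
    unfolding resolvent_def using n G s by (intro divide_right_mono) auto
  also have "\<dots> = 2 / (1 - s)"
    using G by simp
  finally show "resolvent P s x \<le> 2 / (1 - s)" .
qed

text \<open>The first-step equation of the survival generating function. Away from the ground state the
  resolvent is affine in the Green function, so the equation is inherited from \<open>green_step\<close>, whose
  source term is cancelled by the summand \<open>of_bool (x = ground)\<close>. Since \<open>G\<^sub>s(ground) - G\<^sub>s\<close> vanishes
  at the ground state, excluding a step to it changes nothing.\<close>

lemma resolvent_step:
  assumes s: "0 < s" "s < 1" and x: "x \<in> bits"
  shows "resolvent P s x =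
    1 + s * (\<integral>k. (if flip k x = ground then 0 else resolvent P s (flip k x)) \<partial>measure_pmf P)"
proof -
  define g where "g = green P s ground"
  have g: "1 / 2 \<le> g"
    using green_ground_ge_half[OF s] by (simp add: g_def)
  have "(\<integral>k. (if flip k x = ground then 0 else resolvent P s (flip k x)) \<partial>measure_pmf P)
      = (\<integral>k. (g - green P s (flip k x)) / ((1 - s) * g) \<partial>measure_pmf P)"
    by (intro Bochner_Integration.integral_cong) (auto simp: resolvent_def g_def)
  also have "\<dots> = (g - (\<integral>k. green P s (flip k x) \<partial>measure_pmf P)) / ((1 - s) * g)"
    using integrable_pmf_bounded[of "\<lambda>k. green P s (flip k x)" g P] abs_green_le[OF s, of P]
    by (simp add: g_def measure_pmf.prob_space)
  finally have I: "(\<integral>k. (if flip k x = ground then 0 else resolvent P s (flip k x)) \<partial>measure_pmf P)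
      = (g - (\<integral>k. green P s (flip k x) \<partial>measure_pmf P)) / ((1 - s) * g)" .
  show ?thesis
    unfolding I
    unfolding resolvent_def g_def[symmetric] green_step[OF s x]
    using g s by (simp add: field_simps)
qed

lemma survival_gf_Suc:
  "(\<Sum>n<Suc N. s ^ n * survival P n x) =
    1 + s * (\<integral>k. (if flip k x = ground then 0 else \<Sum>n<N. s ^ n * survival P n (flip k x)) \<partial>measure_pmf P)"
proof -
  have int: "integrable (measure_pmf P) (\<lambda>k. if flip k x = ground then 0 else survival P n (flip k x))" for n
    by (intro integrable_pmf_bounded[where B = 1]) auto
  have "(\<integral>k. (if flip k x = ground then 0 else \<Sum>n<N. s ^ n * survival P n (flip k x)) \<partial>measure_pmf P)
      = (\<integral>k. (\<Sum>n<N. s ^ n * (if flip k x = ground then 0 else survival P n (flip k x))) \<partial>measure_pmf P)"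
    by (intro Bochner_Integration.integral_cong) auto
  also have "\<dots> = (\<Sum>n<N. s ^ n * survival P (Suc n) x)"
    using int by (simp add: survival_Suc)
  finally show ?thesis
    by (subst sum.lessThan_Suc_shift) (simp add: sum_distrib_left mult.assoc)
qed

lemma abs_survival_gf_le:
  assumes "0 < s" "s < 1"
  shows "\<bar>\<Sum>n<N. s ^ n * survival P n x\<bar> \<le> real N"
proof -
  have "\<bar>\<Sum>n<N. s ^ n * survival P n x\<bar> \<le> (\<Sum>n<N. \<bar>s ^ n * survival P n x\<bar>)"
    by (rule sum_abs)
  also have "\<dots> \<le> (\<Sum>n<N. 1)"
    using assms by (intro sum_mono) (auto simp: abs_mult intro!: mult_le_one power_le_one)
  finally show ?thesis by simp
qed

text \<open>The partial sums start at 0 and iterate the same monotone first-step map of which the resolvent is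
  a fixed point. Hence they stay below it; since the map contracts by the factor \<open>s\<close> and the
  resolvent is at most \<open>2 / (1 - s)\<close>, they also come within \<open>s^N 2 / (1 - s)\<close> of it.\<close>

lemma survival_gf_bounds:
  assumes s: "0 < s" "s < 1" and "x \<in> bits"
  shows "(\<Sum>n<N. s ^ n * survival P n x) \<le> resolvent P s x"
    and "resolvent P s x \<le> (\<Sum>n<N. s ^ n * survival P n x) + s ^ N * (2 / (1 - s))"
  using \<open>x \<in> bits\<close>
proof (induction N arbitrary: x)
  case 0
  {
    case 1
    show ?case using resolvent_bounds[OF s] by simp
  next
    case 2
    show ?case using resolvent_bounds[OF s] by simp
  }
next
  case (Suc N)
  let ?H = "\<lambda>y. \<Sum>n<N. s ^ n * survival P n y"
  let ?T = "\<lambda>f x. \<integral>k. (if flip k x = ground then 0 else f (flip k x)) \<partial>measure_pmf P"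
  have intH: "integrable (measure_pmf P) (\<lambda>k. if flip k x = ground then 0 else ?H (flip k x))" for x
    using abs_survival_gf_le[OF s] by (intro integrable_pmf_bounded[where B = "real N"]) auto
  have intW: "integrable (measure_pmf P) (\<lambda>k. if flip k x = ground then 0 else resolvent P s (flip k x))" for x
    using resolvent_bounds[OF s, of P] s
    by (intro integrable_pmf_bounded[where B = "2 / (1 - s)"]) auto
  {
    case (1 x)
    have le: "(if flip k x = ground then 0 else ?H (flip k x))
        \<le> (if flip k x = ground then 0 else resolvent P s (flip k x))" for k
      using Suc(1)[OF flip_bits[OF 1]] by simp
    have "?T ?H x \<le> ?T (resolvent P s) x"
      by (intro integral_mono intH intW le)
    then show ?case
      unfolding survival_gf_Suc resolvent_step[OF s 1] using s by (simp add: mult_left_mono)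
  next
    case (2 x)
    have "?T (resolvent P s) x \<le> (\<integral>k. (if flip k x = ground then 0 else ?H (flip k x)) + s ^ N * (2 / (1 - s)) \<partial>measure_pmf P)"
      by (intro integral_mono intW Bochner_Integration.integrable_add intH) (use 2 Suc s in auto)
    also have "\<dots> = ?T ?H x + s ^ N * (2 / (1 - s))"
      using intH by (simp add: measure_pmf.prob_space)
    finally have "s * ?T (resolvent P s) x \<le> s * (?T ?H x + s ^ N * (2 / (1 - s)))"
      using s by (intro mult_left_mono) auto
    then show ?case
      unfolding survival_gf_Suc resolvent_step[OF s 2] by (simp add: algebra_simps)
  }
qed

text \<open>A Tauberian bound: the survival probabilities decrease, so the first \<open>n\<close> terms of the generating
  function are at least \<open>n s^n survival P n x\<close>. With \<open>1 - s = 1 / (2n)\<close>, Bernoulli's inequality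
  makes \<open>s^n\<close> at least 1/2.\<close>

lemma survival_le_green:
  assumes "1 \<le> n" and x: "x \<in> bits" and s: "s = 1 - 1 / (2 * real n)"
  shows "survival P n x \<le> 4 * (green P s ground - green P s x + of_bool (x = ground)) / green P s ground"
proof -
  define q where "q = (green P s ground - green P s x + of_bool (x = ground)) / green P s ground"
  have s01: "0 < s" "s < 1"
    using assms(1) by (auto simp: s field_simps)
  \<comment> \<open>Bernoulli: \<open>(1 - 1 / (2 n)) ^ n \<ge> 1 - n / (2 n)\<close>.\<close>
  have "1 / 2 \<le> s ^ n"
    using Bernoulli_inequality[of "- 1 / (2 * real n)" n] assms(1) by (simp add: s field_simps)
  then have "real n * survival P n x / 2 \<le> (\<Sum>k<n. s ^ n * survival P n x)"
    using mult_right_mono[of "1 / 2" "s ^ n" "real n * survival P n x"] by (simp add: algebra_simps)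
  also have "\<dots> \<le> (\<Sum>k<n. s ^ k * survival P k x)"
    using s01 by (intro sum_mono mult_mono survival_antimono power_decreasing) auto
  also have "\<dots> \<le> resolvent P s x"
    using survival_gf_bounds[OF s01 x] by simp
  also have "\<dots> = 2 * real n * q"
    using assms(1) by (simp add: resolvent_def q_def s)
  finally have "real n * survival P n x \<le> real n * (4 * q)"
    by simp
  then have "survival P n x \<le> 4 * q"
    using assms(1) by (subst (asm) mult_le_cancel_left_pos) auto
  then show ?thesis
    by (simp add: q_def)
qed

section \<open>The Green function at geometric scales\<close>

lemma integrable_coins_indicator:
  fixes v :: real
  assumes "A \<in> sets coins"
  shows "integrable coins (\<lambda>a. indicator A a * v)"
  using assms by (intro integrable_mult_left integrable_real_indicator) (simp_all add: coins.emeasure_eq_measure)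

lemma coins_cylinder_sets:
  assumes "finite J"
  shows "{a. \<forall>k\<in>J. a k = b k} \<in> sets coins"
proof -
  have "{a \<in> space coins. \<forall>k\<in>J. a k = b k} \<in> sets coins"
    using assms by measurable
  then show ?thesis by simp
qed

text \<open>The asymptotics of \<open>P\<close> enter through two-sided geometric bounds on the mass of every bit.\<close>

locale geometric_law =
  fixes P :: "nat pmf" and p c C :: real
  assumes p: "0 < p" "p < 1/2" and c: "0 < c" and C: "0 < C"
    and P_0: "pmf P 0 = 0"
    and P_lower: "\<And>k. 1 \<le> k \<Longrightarrow> c * p ^ k \<le> pmf P k"
    and P_upper: "\<And>k. 1 \<le> k \<Longrightarrow> pmf P k \<le> C * p ^ k"
begin

text \<open>The constant stays \<open>C\<close> because \<open>p / (1 - p) \<le> 1\<close>.\<close>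

lemma tail_mass_le: "measure_pmf.prob P {K<..} \<le> C * p ^ K"
proof -
  have "(\<lambda>n. measure_pmf.prob P {Suc K + n}) sums measure_pmf.prob P (\<Union>n. {Suc K + n})"
    by (intro measure_pmf.finite_measure_UNION) (auto simp: disjoint_family_on_def)
  moreover have "(\<Union>n. {Suc K + n}) = {K<..}"
    using less_iff_Suc_add by auto
  ultimately have 1: "(\<lambda>n. pmf P (Suc K + n)) sums measure_pmf.prob P {K<..}"
    by (simp add: measure_pmf_single)
  have 2: "(\<lambda>n. C * p ^ Suc K * p ^ n) sums (C * p ^ Suc K * (1 / (1 - p)))"
    using p by (intro sums_mult geometric_sums) simp
  have "measure_pmf.prob P {K<..} \<le> C * p ^ Suc K * (1 / (1 - p))"
  proof (rule sums_le[OF _ 1 2])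
    fix n
    show "pmf P (Suc K + n) \<le> C * p ^ Suc K * p ^ n"
      using P_upper[of "Suc K + n"] by (simp add: power_add mult.assoc)
  qed
  also have "\<dots> = C * p ^ K * (p / (1 - p))"
    by simp
  also have "\<dots> \<le> C * p ^ K * 1"
    using p C by (intro mult_left_mono) (auto simp: field_simps)
  finally show ?thesis by simp
qed

text \<open>With probability \<open>2^-K\<close> none of the bits \<open>1, ..., K\<close> is selected, and then the hit mass is at most
  the tail mass beyond \<open>K\<close>.\<close>

lemma green_ground_lower:
  assumes s: "0 < s" "s < 1"
  shows "(1 / 2) ^ K / (1 - s + 2 * (C * p ^ K)) \<le> green P s ground"
proof -
  let ?Z = "{a. \<forall>k\<in>{1..K}. a k = False}" and ?v = "1 / (1 - s + 2 * (C * p ^ K))"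
  have tail_pos: "0 < C * p ^ K" using C p by simp
  have "indicator ?Z a * ?v \<le> weight P s a" for a
  proof (cases "a \<in> ?Z")
    case True
    \<comment> \<open>The coin of coordinate 0 is unconstrained, but this coordinate has mass 0.\<close>
    have "hit_mass P a \<le> measure_pmf.prob P ({K<..} \<union> {0})"
      unfolding hit_mass_def using True
      by (intro measure_pmf.finite_measure_mono) force+
    also have "\<dots> \<le> measure_pmf.prob P {K<..} + measure_pmf.prob P {0}"
      by (intro measure_Un_le) auto
    finally have "hit_mass P a \<le> C * p ^ K"
      using tail_mass_le[of K] P_0 by (simp add: measure_pmf_single)
    then have "s * hit_mass P a \<le> 1 * (C * p ^ K)"
      using s tail_pos by (intro mult_mono) auto
    moreover have "0 \<le> s * hit_mass P a"
      using s by simp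
    ultimately have "?v \<le> weight P s a"
      unfolding weight_def using s by (intro frac_le) linarith+
    then show ?thesis using True by simp
  next
    case False
    then show ?thesis using weight_bounds(1)[OF s, of P a] by simp
  qed
  then have "(\<integral>a. indicator ?Z a * ?v \<partial>coins) \<le> green P s ground"
    unfolding green_ground
    by (intro integral_mono weight_integrable s integrable_coins_indicator coins_cylinder_sets) simp
  moreover have "(\<integral>a. indicator ?Z a * ?v \<partial>coins) = measure coins ?Z * ?v"
    by (simp add: Int_def)
  moreover have "measure coins ?Z = (1 / 2) ^ K"
    by (subst coins_cylinder) simp_all
  ultimately show ?thesis by simp
qed

text \<open>The event that \<open>k\<close> is the least selected bit, numbered from 1.\<close>

definition first_selected :: "nat \<Rightarrow> (nat \<Rightarrow> bool) set" where
  "first_selected k = {a. \<forall>j\<in>{1..k}. a j = (j = k)}"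

lemma first_selected_sets [measurable]: "first_selected k \<in> sets coins"
  unfolding first_selected_def by (rule coins_cylinder_sets) simp

lemma prob_first_selected: "measure coins (first_selected k) = (1 / 2) ^ k"
  using coins_cylinder[of "{1..k}" "\<lambda>j. j = k"] by (simp add: first_selected_def)

lemma first_selected_exhaust:
  assumes "\<exists>j\<in>{1..m}. a j"
  obtains k where "k \<in> {1..m}" "a \<in> first_selected k"
proof -
  define k where "k = (LEAST j. 1 \<le> j \<and> a j)"
  from assms obtain j where j: "1 \<le> j \<and> a j" "j \<le> m"
    by auto
  have "1 \<le> k \<and> a k" "k \<le> m"
    unfolding k_def using LeastI[of "\<lambda>j. 1 \<le> j \<and> a j", OF j(1)] Least_le[of "\<lambda>j. 1 \<le> j \<and> a j", OF j(1)] j(2)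
    by auto
  moreover have "\<not> a j" if "1 \<le> j" "j < k" for j
    using not_less_Least[of j "\<lambda>j. 1 \<le> j \<and> a j"] that by (auto simp: k_def)
  ultimately show thesis
    by (intro that[of k]) (auto simp: first_selected_def order.order_iff_strict)
qed

text \<open>Bit \<open>k\<close> alone contributes \<open>pmf P k\<close> to the hit mass.\<close>

lemma weight_le_first_selected:
  assumes s: "0 < s" "s < 1" and a: "a \<in> first_selected k" and k: "1 \<le> k"
  shows "2 * weight P s a \<le> 1 / (s * (c * p ^ k))"
proof -
  have "c * p ^ k \<le> measure_pmf.prob P {k}"
    using P_lower[OF k] by (simp add: measure_pmf_single)
  also have "\<dots> \<le> hit_mass P a"
    unfolding hit_mass_def using a k
    by (intro measure_pmf.finite_measure_mono) (auto simp: first_selected_def)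
  finally have "2 * s * (c * p ^ k) \<le> 2 * s * hit_mass P a"
    using s by (intro mult_left_mono) auto
  then have "2 * s * (c * p ^ k) \<le> 1 - s + 2 * s * hit_mass P a"
    using s by linarith
  then have "2 / (1 - s + 2 * s * hit_mass P a) \<le> 2 / (2 * s * (c * p ^ k))"
    using s c p by (intro frac_le) auto
  then show ?thesis
    by (simp add: weight_def)
qed

definition scale_const :: real where
  "scale_const = 2 / (c * (1 - 2 * p))"

lemma scale_const_pos: "0 < scale_const"
  using c p by (simp add: scale_const_def)

lemma sum_scales_le: "(\<Sum>k=1..m. (1 / (2 * p)) ^ k) \<le> (1 / (2 * p)) ^ m / (1 - 2 * p)"
proof (induction m)
  case 0
  then show ?case using p by simp
next
  case (Suc m)
  have "(\<Sum>k=1..Suc m. (1 / (2 * p)) ^ k) \<le> (1 / (2 * p)) ^ m / (1 - 2 * p) + (1 / (2 * p)) ^ Suc m"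
    using Suc by simp
  also have "\<dots> = (1 / (2 * p)) ^ Suc m / (1 - 2 * p)"
    using p by (simp add: field_simps)
  finally show ?case .
qed

text \<open>The scale \<open>k\<close> contributes at most a constant times \<open>2^-k p^-k\<close>; since \<open>2p < 1\<close>, the last scale
  dominates.\<close>

lemma first_selected_sum_le:
  assumes "1 / 2 \<le> s"
  shows "(\<Sum>k=1..m. measure coins (first_selected k) * (1 / (s * (c * p ^ k))))
    \<le> scale_const * (1 / (2 * p)) ^ m"
proof -
  have "measure coins (first_selected k) * (1 / (s * (c * p ^ k))) \<le> 2 / c * (1 / (2 * p)) ^ k" for k
  proof -
    have "1 / s \<le> 2" using assms by (simp add: field_simps)
    then have "1 / s * (1 / c * (1 / (2 * p)) ^ k) \<le> 2 * (1 / c * (1 / (2 * p)) ^ k)"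
      using c p by (intro mult_right_mono) auto
    then show ?thesis
      by (simp add: prob_first_selected power_divide power_mult_distrib mult_ac)
  qed
  then have "(\<Sum>k=1..m. measure coins (first_selected k) * (1 / (s * (c * p ^ k))))
      \<le> 2 / c * (\<Sum>k=1..m. (1 / (2 * p)) ^ k)"
    unfolding sum_distrib_left by (intro sum_mono)
  also have "\<dots> \<le> 2 / c * ((1 / (2 * p)) ^ m / (1 - 2 * p))"
    using c by (intro mult_left_mono sum_scales_le) auto
  finally show ?thesis by (simp add: scale_const_def)
qed

text \<open>The characters of \<open>x\<close> and of the ground state differ only if one of the bits \<open>1, ..., m\<close> is
  selected, and on that event the weight is controlled by the first selected bit, whatever \<open>s\<close> is.\<close>

lemma green_difference_le:
  assumes s: "1 / 2 \<le> s" "s < 1" and x: "\<And>k. x k \<noteq> 0 \<Longrightarrow> 1 \<le> k \<and> k \<le> m"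
  shows "green P s ground - green P s x \<le> scale_const * (1 / (2 * p)) ^ m"
proof -
  have s0: "0 < s" using s by simp
  let ?v = "\<lambda>k. 1 / (s * (c * p ^ k))"
  have v: "0 \<le> ?v k" for k using s0 c p by simp
  have int: "integrable coins (\<lambda>a. indicator (first_selected k) a * ?v k)" for k
    by (rule integrable_coins_indicator) simp
  have "weight P s a - character x a * weight P s a
      \<le> (\<Sum>k=1..m. indicator (first_selected k) a * ?v k)" for a
  proof (cases "\<exists>j\<in>{1..m}. a j")
    case True
    then obtain k where k: "k \<in> {1..m}" "a \<in> first_selected k"
      using first_selected_exhaust by metis
    have "- 1 \<le> character x a"
      using abs_character[of x a] by linarith
    then have "weight P s a - character x a * weight P s a \<le> 2 * weight P s a"
      using mult_right_mono[of "- 1" "character x a" "weight P s a"] weight_bounds(1)[OF s0 s(2), of P a]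
      by simp
    also have "\<dots> \<le> ?v k"
      using weight_le_first_selected[OF s0 s(2) k(2)] k(1) by simp
    also have "\<dots> = indicator (first_selected k) a * ?v k"
      using k by simp
    also have "\<dots> \<le> (\<Sum>k=1..m. indicator (first_selected k) a * ?v k)"
      using k(1) v by (intro member_le_sum) auto
    finally show ?thesis .
  next
    case False
    then have "character x a = 1"
      unfolding character_def using x by (intro prod.neutral) (auto simp: bit_sign_def)
    moreover have "0 \<le> (\<Sum>k=1..m. indicator (first_selected k) a * ?v k)"
      using v by (intro sum_nonneg mult_nonneg_nonneg) auto
    ultimately show ?thesis by simp
  qed
  then have "(\<integral>a. weight P s a - character x a * weight P s a \<partial>coins)
      \<le> (\<integral>a. (\<Sum>k=1..m. indicator (first_selected k) a * ?v k) \<partial>coins)"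
    by (intro integral_mono Bochner_Integration.integrable_sum int
        Bochner_Integration.integrable_diff weight_integrable s0 s)
  also have "\<dots> = (\<Sum>k=1..m. measure coins (first_selected k) * ?v k)"
    using int by simp
  also have "\<dots> \<le> scale_const * (1 / (2 * p)) ^ m"
    by (rule first_selected_sum_le[OF s(1)])
  finally show ?thesis
    using weight_integrable(1)[OF s0 s(2), of P] weight_integrable(2)[OF s0 s(2), of x P]
    by (simp add: green_def green_ground)
qed

text \<open>If a bit up to \<open>K\<close> is selected, the first such bit controls the weight; otherwise the trivial
  bound \<open>1 / (1 - s)\<close> is used on an event of probability \<open>2^-K\<close>.\<close>

lemma green_ground_upper:
  assumes s: "1 / 2 \<le> s" "s < 1"
  shows "green P s ground \<le> scale_const * (1 / (2 * p)) ^ K + (1 / 2) ^ K / (1 - s)"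
proof -
  have s0: "0 < s" using s by simp
  let ?v = "\<lambda>k. 1 / (s * (c * p ^ k))"
  let ?Z = "{a. \<forall>k\<in>{1..K}. a k = False}"
  have v: "0 \<le> ?v k" for k using s0 c p by simp
  have int: "integrable coins (\<lambda>a. indicator (first_selected k) a * ?v k)" for k
    by (rule integrable_coins_indicator) simp
  have intZ: "integrable coins (\<lambda>a. indicator ?Z a * (1 / (1 - s)))"
    by (intro integrable_coins_indicator coins_cylinder_sets) simp
  have "weight P s a \<le> (\<Sum>k=1..K. indicator (first_selected k) a * ?v k) + indicator ?Z a * (1 / (1 - s))" for a
  proof (cases "\<exists>j\<in>{1..K}. a j")
    case True
    then obtain k where k: "k \<in> {1..K}" "a \<in> first_selected k"
      using first_selected_exhaust by metis
    have "weight P s a \<le> 2 * weight P s a"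
      using weight_bounds(1)[OF s0 s(2), of P a] by simp
    also have "\<dots> \<le> ?v k"
      using weight_le_first_selected[OF s0 s(2) k(2)] k(1) by simp
    also have "\<dots> = indicator (first_selected k) a * ?v k"
      using k by simp
    also have "\<dots> \<le> (\<Sum>k=1..K. indicator (first_selected k) a * ?v k)"
      using k(1) v by (intro member_le_sum) auto
    also have "\<dots> \<le> \<dots> + indicator ?Z a * (1 / (1 - s))"
      using s by simp
    finally show ?thesis .
  next
    case False
    then have "weight P s a \<le> indicator ?Z a * (1 / (1 - s))"
      using weight_bounds(2)[OF s0 s(2), of P a] by simp
    moreover have "0 \<le> (\<Sum>k=1..K. indicator (first_selected k) a * ?v k)"
      using v by (intro sum_nonneg mult_nonneg_nonneg) auto
    ultimately show ?thesis by linarith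
  qed
  then have "green P s ground
      \<le> (\<integral>a. (\<Sum>k=1..K. indicator (first_selected k) a * ?v k) + indicator ?Z a * (1 / (1 - s)) \<partial>coins)"
    unfolding green_ground
    by (intro integral_mono Bochner_Integration.integrable_add Bochner_Integration.integrable_sum
        int intZ weight_integrable s0 s)
  also have "\<dots> = (\<Sum>k=1..K. measure coins (first_selected k) * ?v k) + measure coins ?Z * (1 / (1 - s))"
    by (subst Bochner_Integration.integral_add) (use int intZ in \<open>simp_all add: Int_def\<close>)
  also have "\<dots> \<le> scale_const * (1 / (2 * p)) ^ K + (1 / 2) ^ K / (1 - s)"
    using first_selected_sum_le[OF s(1), of K] coins_cylinder[of "{1..K}" "\<lambda>_. False"] by simp
  finally show ?thesis .
qed

end

section \<open>Return time of the chain and survival probabilities\<close>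

lemma pmf_replicate_Cons:
  "pmf (replicate_pmf (Suc n) P) (k # l) = pmf P k * pmf (replicate_pmf n P) l"
proof -
  have "replicate_pmf (Suc n) P = map_pmf (\<lambda>(k, l). k # l) (pair_pmf P (replicate_pmf n P))"
    by (simp add: pair_pmf_def map_pmf_def bind_assoc_pmf bind_return_pmf)
  moreover have "inj (\<lambda>(k, l). k # l :: 'a list)"
    by (auto simp: inj_on_def)
  ultimately show ?thesis
    using pmf_map_inj'[of "\<lambda>(k, l). k # l" "pair_pmf P (replicate_pmf n P)" "(k, l)"]
    by (simp add: pmf_pair)
qed

lemma pmf_replicate:
  assumes "length l = n"
  shows "pmf (replicate_pmf n P) l = (\<Prod>i<n. pmf P (l ! i))"
  using assms
proof (induction n arbitrary: l)
  case 0
  then show ?case by simp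
next
  case (Suc n)
  then obtain k l' where l: "l = k # l'" "length l' = n"
    by (auto simp: length_Suc_conv)
  show ?case
    unfolding l(1) pmf_replicate_Cons Suc.IH[OF l(2)]
    by (simp only: prod.lessThan_Suc_shift nth_Cons_0 nth_Cons_Suc)
qed

definition driving_path :: "(nat \<Rightarrow> 'a \<Rightarrow> nat) \<Rightarrow> nat \<Rightarrow> 'a \<Rightarrow> nat list" where
  "driving_path \<xi> n \<omega> = map (\<lambda>i. \<xi> (Suc i) \<omega>) [0..<n]"

lemma length_driving_path [simp]: "length (driving_path \<xi> n \<omega>) = n"
  by (simp add: driving_path_def)

lemma driving_path_Suc: "driving_path \<xi> (Suc n) \<omega> = driving_path \<xi> n \<omega> @ [\<xi> (Suc n) \<omega>]"
  by (simp add: driving_path_def)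

lemma bf_chain_Suc_flip:
  "bf_chain \<xi> \<zeta>0 (Suc n) \<omega> = flip (\<xi> (Suc n) \<omega>) (bf_chain \<xi> \<zeta>0 n \<omega>)"
  by (simp add: flip_def)

lemma bf_chain_eq_fold: "bf_chain \<xi> \<zeta>0 n \<omega> = fold flip (driving_path \<xi> n \<omega>) (\<zeta>0 \<omega>)"
proof (induction n)
  case 0
  then show ?case by (simp add: driving_path_def)
next
  case (Suc n)
  then show ?case
    unfolding bf_chain_Suc_flip driving_path_Suc by simp
qed

lemma avoids_ground_append:
  "avoids_ground x (l @ [k]) \<longleftrightarrow> avoids_ground x l \<and> fold flip (l @ [k]) x \<noteq> ground"
  by (induction l arbitrary: x) simp_all

lemma avoids_ground_iff:
  "avoids_ground (\<zeta>0 \<omega>) (driving_path \<xi> n \<omega>) \<longleftrightarrow> (\<forall>i\<in>{1..n}. bf_chain \<xi> \<zeta>0 i \<omega> \<noteq> ground)"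
proof (induction n)
  case 0
  then show ?case by (simp add: driving_path_def)
next
  case (Suc n)
  have "bf_chain \<xi> \<zeta>0 (Suc n) \<omega> = fold flip (driving_path \<xi> n \<omega> @ [\<xi> (Suc n) \<omega>]) (\<zeta>0 \<omega>)"
    by (simp only: bf_chain_eq_fold driving_path_Suc)
  moreover have "(\<forall>i\<in>{1..Suc n}. Q i) \<longleftrightarrow> (\<forall>i\<in>{1..n}. Q i) \<and> Q (Suc n)" for Q
    by (auto simp: atLeastAtMostSuc_conv)
  ultimately show ?case
    by (simp only: driving_path_Suc avoids_ground_append Suc.IH)
qed

lemma return_time_gt_iff:
  "enat n < bf_return_time \<xi> \<zeta>0 \<omega> \<longleftrightarrow> avoids_ground (\<zeta>0 \<omega>) (driving_path \<xi> n \<omega>)"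
proof -
  let ?R = "\<lambda>i. i \<ge> 1 \<and> bf_chain \<xi> \<zeta>0 i \<omega> = ground"
  have "n < (LEAST i. ?R i) \<longleftrightarrow> (\<forall>i\<in>{1..n}. bf_chain \<xi> \<zeta>0 i \<omega> \<noteq> ground)" if "\<exists>i. ?R i"
  proof
    assume n: "n < (LEAST i. ?R i)"
    show "\<forall>i\<in>{1..n}. bf_chain \<xi> \<zeta>0 i \<omega> \<noteq> ground"
    proof
      fix i assume "i \<in> {1..n}"
      then show "bf_chain \<xi> \<zeta>0 i \<omega> \<noteq> ground"
        using not_less_Least[of i ?R] n by simp
    qed
  next
    assume "\<forall>i\<in>{1..n}. bf_chain \<xi> \<zeta>0 i \<omega> \<noteq> ground"
    then show "n < (LEAST i. ?R i)"
      using LeastI_ex[OF that] by (meson atLeastAtMost_iff not_le)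
  qed
  then show ?thesis
    unfolding avoids_ground_iff bf_return_time_def by auto
qed

context bf_model
begin

lemma \<xi>_measurable: "1 \<le> i \<Longrightarrow> \<xi> i \<in> measurable M (count_space UNIV)"
  by (rule bspec[OF indep_\<xi>[unfolded indep_vars_def, THEN conjunct1]]) simp

lemma \<zeta>0_measurable: "\<zeta>0 \<in> measurable M (count_space bf_states)"
  using indep_var_rv1[OF indep_init] .

lemma \<zeta>0_states: "\<omega> \<in> space M \<Longrightarrow> \<zeta>0 \<omega> \<in> bf_states"
  using measurable_space[OF \<zeta>0_measurable] unfolding space_count_space .

lemma init_event_sets: "{\<omega> \<in> space M. \<zeta>0 \<omega> = x} \<in> events"
proof (cases "x \<in> bf_states")
  case True
  then have "\<zeta>0 -` {x} \<inter> space M \<in> events"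
    by (intro measurable_sets[OF \<zeta>0_measurable]) simp
  moreover have "\<zeta>0 -` {x} \<inter> space M = {\<omega> \<in> space M. \<zeta>0 \<omega> = x}"
    by blast
  ultimately show ?thesis by (simp only:)
next
  case False
  then have "{\<omega> \<in> space M. \<zeta>0 \<omega> = x} = {}"
    using \<zeta>0_states by blast
  then show ?thesis by (simp only: sets.empty_sets)
qed

lemma driving_path_event_sets: "{\<omega> \<in> space M. driving_path \<xi> n \<omega> \<in> B} \<in> events"
proof -
  have path: "driving_path \<xi> n \<in> measurable M (count_space UNIV)"
  proof (induction n)
    case 0
    then show ?case by (simp add: driving_path_def)
  next
    case (Suc n)
    have "(\<lambda>\<omega>. driving_path \<xi> n \<omega> @ [\<xi> (Suc n) \<omega>]) \<in> measurable M (count_space UNIV)"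
    proof (rule measurable_compose_countable[OF _ Suc])
      fix l
      show "(\<lambda>\<omega>. l @ [\<xi> (Suc n) \<omega>]) \<in> measurable M (count_space UNIV)"
        by (rule measurable_compose[OF \<xi>_measurable measurable_count_space]) simp
    qed
    then show ?case
      by (simp only: driving_path_Suc[abs_def])
  qed
  have "{\<omega> \<in> space M. driving_path \<xi> n \<omega> \<in> B} = driving_path \<xi> n -` B \<inter> space M"
    by auto
  then show ?thesis
    by (simp only:) (rule measurable_sets[OF path], simp)
qed

lemma prob_path_singleton:
  assumes x: "x \<in> bf_states" and l: "length l = n"
  shows "prob {\<omega> \<in> space M. \<zeta>0 \<omega> = x \<and> driving_path \<xi> n \<omega> = l}
    = prob {\<omega> \<in> space M. \<zeta>0 \<omega> = x} * pmf (replicate_pmf n P) l"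
proof (cases "n = 0")
  case True
  then show ?thesis using l by (simp add: driving_path_def)
next
  case False
  let ?\<Xi> = "\<lambda>\<omega>. \<lambda>i\<in>{1..}. \<xi> i \<omega>"
  define X where "X = {a \<in> space (PiM {1..} (\<lambda>_::nat. count_space (UNIV :: nat set))).
    \<forall>i\<in>{1..n}. a i = l ! (i - 1)}"
  have X: "X \<in> sets (PiM {1..} (\<lambda>_. count_space UNIV))"
    unfolding X_def by (intro sets.sets_Collect_finite_All sets_Collect_single') auto
  have path: "driving_path \<xi> n \<omega> = l \<longleftrightarrow> (\<forall>i\<in>{1..n}. \<xi> i \<omega> = l ! (i - 1))" for \<omega>
    unfolding list_eq_iff_nth_eq image_Suc_lessThan[symmetric] using l
    by (auto simp: driving_path_def simp del: image_Suc_lessThan)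
  have \<Xi>: "?\<Xi> \<omega> \<in> X \<longleftrightarrow> (\<forall>i\<in>{1..n}. \<xi> i \<omega> = l ! (i - 1))" for \<omega>
    by (simp add: X_def space_PiM)
  have "{\<omega> \<in> space M. \<zeta>0 \<omega> = x \<and> driving_path \<xi> n \<omega> = l}
      = (\<lambda>\<omega>. (\<zeta>0 \<omega>, ?\<Xi> \<omega>)) -` ({x} \<times> X) \<inter> space M"
    unfolding path \<Xi>[symmetric] by blast
  then have "prob {\<omega> \<in> space M. \<zeta>0 \<omega> = x \<and> driving_path \<xi> n \<omega> = l}
      = prob ((\<lambda>\<omega>. (\<zeta>0 \<omega>, ?\<Xi> \<omega>)) -` ({x} \<times> X) \<inter> space M)"
    by (rule arg_cong)
  also have "\<dots> = prob (\<zeta>0 -` {x} \<inter> space M) * prob (?\<Xi> -` X \<inter> space M)"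
    by (rule indep_varD[OF indep_init]) (use x X in simp_all)
  also have "\<zeta>0 -` {x} \<inter> space M = {\<omega> \<in> space M. \<zeta>0 \<omega> = x}"
    by blast
  also have "?\<Xi> -` X \<inter> space M = {\<omega> \<in> space M. \<forall>i\<in>{1..n}. \<xi> i \<omega> = l ! (i - 1)}"
    unfolding \<Xi>[symmetric] by blast
  also have "\<dots> = (\<Inter>i\<in>{1..n}. \<xi> i -` {l ! (i - 1)} \<inter> space M)"
    using False by auto
  also have "prob (\<Inter>i\<in>{1..n}. \<xi> i -` {l ! (i - 1)} \<inter> space M) = (\<Prod>i\<in>{1..n}. prob (\<xi> i -` {l ! (i - 1)} \<inter> space M))"
    by (rule indep_varsD[OF indep_\<xi>]) (use False in auto)
  also have "\<dots> = (\<Prod>i\<in>{1..n}. pmf P (l ! (i - 1)))"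
  proof (rule prod.cong[OF refl])
    fix i assume "i \<in> {1..n}"
    then show "prob (\<xi> i -` {l ! (i - 1)} \<inter> space M) = pmf P (l ! (i - 1))"
      using distr_\<xi>[of i "l ! (i - 1)"] by (simp add: vimage_def Int_def conj_commute)
  qed
  also have "\<dots> = pmf (replicate_pmf n P) l"
    unfolding pmf_replicate[OF l]
    by (rule prod.reindex_bij_witness[of _ Suc "\<lambda>i. i - 1"]) auto
  finally show ?thesis .
qed

text \<open>The initial state is independent of the path \<open>\<xi> 1, ..., \<xi> n\<close>, which has the law of \<open>n\<close> independent
  draws from \<open>P\<close>. The law is checked on single lists, which suffices as there are countably many.\<close>

lemma prob_path:
  assumes x: "x \<in> bf_states"
  shows "prob {\<omega> \<in> space M. \<zeta>0 \<omega> = x \<and> driving_path \<xi> n \<omega> \<in> B}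
    = prob {\<omega> \<in> space M. \<zeta>0 \<omega> = x} * measure_pmf.prob (replicate_pmf n P) B"
proof -
  define q where "q = prob {\<omega> \<in> space M. \<zeta>0 \<omega> = x}"
  let ?E = "\<lambda>l. {\<omega> \<in> space M. \<zeta>0 \<omega> = x \<and> driving_path \<xi> n \<omega> = l}"
  have single: "emeasure M (?E l) = ennreal q * ennreal (pmf (replicate_pmf n P) l)" for l
  proof (cases "length l = n")
    case True
    then show ?thesis
      by (simp add: emeasure_eq_measure prob_path_singleton[OF x] q_def ennreal_mult)
  next
    case False
    then have "?E l = {}" by auto
    moreover have "pmf (replicate_pmf n P) l = 0"
      using False set_replicate_pmf[of n P] by (auto simp: set_pmf_iff[symmetric])
    ultimately show ?thesis by (simp del: Collect_empty_eq)
  qed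
  have E: "?E l \<in> events" for l
  proof -
    have "?E l = {\<omega> \<in> space M. \<zeta>0 \<omega> = x} \<inter> {\<omega> \<in> space M. driving_path \<xi> n \<omega> \<in> {l}}" by auto
    then show ?thesis by (simp only: sets.Int[OF init_event_sets driving_path_event_sets])
  qed
  have disj: "disjoint_family_on ?E B"
    unfolding disjoint_family_on_def by blast
  have "{\<omega> \<in> space M. \<zeta>0 \<omega> = x \<and> driving_path \<xi> n \<omega> \<in> B} = (\<Union>l\<in>B. ?E l)"
    by blast
  then have "emeasure M {\<omega> \<in> space M. \<zeta>0 \<omega> = x \<and> driving_path \<xi> n \<omega> \<in> B}
      = emeasure M (\<Union>l\<in>B. ?E l)"
    by (rule arg_cong)
  also have "\<dots> = (\<integral>\<^sup>+l. emeasure M (?E l) \<partial>count_space B)"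
    by (rule emeasure_UN_countable[OF E _ disj]) simp
  also have "\<dots> = ennreal q * emeasure (measure_pmf (replicate_pmf n P)) B"
    by (simp add: single nn_integral_cmult nn_integral_pmf)
  finally have "ennreal (prob {\<omega> \<in> space M. \<zeta>0 \<omega> = x \<and> driving_path \<xi> n \<omega> \<in> B})
      = ennreal (q * measure_pmf.prob (replicate_pmf n P) B)"
    by (simp add: emeasure_eq_measure measure_pmf.emeasure_eq_measure ennreal_mult q_def)
  then show ?thesis
    by (subst (asm) ennreal_inj) (auto simp: q_def)
qed

lemma return_time_event_sets: "{\<omega> \<in> space M. \<zeta>0 \<omega> = x \<and> enat n < bf_return_time \<xi> \<zeta>0 \<omega>} \<in> events"
proof -
  have "{\<omega> \<in> space M. \<zeta>0 \<omega> = x \<and> enat n < bf_return_time \<xi> \<zeta>0 \<omega>}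
      = {\<omega> \<in> space M. \<zeta>0 \<omega> = x} \<inter> {\<omega> \<in> space M. driving_path \<xi> n \<omega> \<in> {l. avoids_ground x l}}"
    by (auto simp: return_time_gt_iff)
  then show ?thesis
    by (simp only: sets.Int[OF init_event_sets driving_path_event_sets])
qed

lemma prob_return_time_gt:
  assumes "x \<in> bf_states"
  shows "prob {\<omega> \<in> space M. \<zeta>0 \<omega> = x \<and> enat n < bf_return_time \<xi> \<zeta>0 \<omega>}
    = prob {\<omega> \<in> space M. \<zeta>0 \<omega> = x} * survival P n x"
proof -
  have "{\<omega> \<in> space M. \<zeta>0 \<omega> = x \<and> enat n < bf_return_time \<xi> \<zeta>0 \<omega>}
      = {\<omega> \<in> space M. \<zeta>0 \<omega> = x \<and> driving_path \<xi> n \<omega> \<in> {l. avoids_ground x l}}"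
    by (auto simp: return_time_gt_iff)
  then show ?thesis
    unfolding survival_def by (simp only:) (rule prob_path[OF assms])
qed

end

lemma bf_states_bits: "x \<in> bf_states \<Longrightarrow> x \<in> bits"
  by (auto simp: bf_states_def bits_def)

lemma active_le_largest_active:
  assumes "x \<in> bf_states" "x k \<noteq> 0"
  shows "1 \<le> k \<and> k \<le> largest_active x"
proof -
  have fin: "finite {k. x k \<noteq> 0}" and "x k \<in> {0, 1}"
    using assms(1) by (auto simp: bf_states_def)
  have "finite {k. x k = 1}"
    by (rule finite_subset[OF _ fin]) auto
  moreover have "x k = 1"
    using assms(2) \<open>x k \<in> {0, 1}\<close> by auto
  moreover have "x \<noteq> ground"
    using assms(2) by (auto simp: ground_def)
  moreover have "k \<noteq> 0"
    using assms by (intro notI) (simp add: bf_states_def)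
  ultimately show ?thesis
    by (auto simp: largest_active_def intro: Max_ge)
qed

text \<open>This turns conditioning on the largest active bit into a finite sum over initial states.\<close>

lemma finite_states_largest_active: "finite {x \<in> bf_states. largest_active x = m}"
proof (rule finite_subset)
  show "{x \<in> bf_states. largest_active x = m} \<subseteq> (\<lambda>A k. of_bool (k \<in> A)) ` Pow {..m}"
  proof
    fix x assume x: "x \<in> {x \<in> bf_states. largest_active x = m}"
    then have "x = (\<lambda>k. of_bool (k \<in> {k. x k \<noteq> 0}))"
      unfolding bf_states_def fun_eq_iff by force
    moreover have "{k. x k \<noteq> 0} \<subseteq> {..m}"
      using x active_le_largest_active[of x] by auto
    ultimately show "x \<in> (\<lambda>A k. of_bool (k \<in> A)) ` Pow {..m}"
      by (intro image_eqI[where x = "{k. x k \<noteq> 0}"]) simp_all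
  qed
qed simp

context bf_model
begin

lemma init_event_eq:
  "bf_init_event M \<zeta>0 m = (\<Union>x\<in>{x \<in> bf_states. largest_active x = m}. {\<omega> \<in> space M. \<zeta>0 \<omega> = x})"
  using \<zeta>0_states by (auto simp: bf_init_event_def)

lemma bf_init_event_sets: "bf_init_event M \<zeta>0 m \<in> events"
  unfolding init_event_eq by (intro sets.finite_UN finite_states_largest_active init_event_sets)

lemma return_time_gt_init_event:
  "bf_init_event M \<zeta>0 m \<inter> {\<omega> \<in> space M. enat n < bf_return_time \<xi> \<zeta>0 \<omega>}
    = (\<Union>x\<in>{x \<in> bf_states. largest_active x = m}. {\<omega> \<in> space M. \<zeta>0 \<omega> = x \<and> enat n < bf_return_time \<xi> \<zeta>0 \<omega>})"
  using \<zeta>0_states by (auto simp: bf_init_event_def)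

lemma return_time_gt_sets: "{\<omega> \<in> space M. enat n < bf_return_time \<xi> \<zeta>0 \<omega>} \<in> events"
proof -
  let ?A = "{\<omega> \<in> space M. enat n < bf_return_time \<xi> \<zeta>0 \<omega>}"
  have "bf_init_event M \<zeta>0 m \<inter> ?A \<in> events" for m
    unfolding return_time_gt_init_event
    by (intro sets.finite_UN finite_states_largest_active return_time_event_sets)
  then have "(\<Union>m. bf_init_event M \<zeta>0 m \<inter> ?A) \<in> events"
    by (intro sets.countable_UN) blast
  moreover have "(\<Union>m. bf_init_event M \<zeta>0 m \<inter> ?A) = ?A"
    unfolding bf_init_event_def by blast
  ultimately show ?thesis
    by (simp only:)
qed

lemma prob_return_time_gt_init_event_le:
  assumes "\<And>x. x \<in> bf_states \<Longrightarrow> largest_active x = m \<Longrightarrow> survival P n x \<le> B"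
  shows "prob (bf_init_event M \<zeta>0 m \<inter> {\<omega> \<in> space M. enat n < bf_return_time \<xi> \<zeta>0 \<omega>})
    \<le> prob (bf_init_event M \<zeta>0 m) * B"
proof -
  let ?S = "{x \<in> bf_states. largest_active x = m}"
  have "prob (bf_init_event M \<zeta>0 m \<inter> {\<omega> \<in> space M. enat n < bf_return_time \<xi> \<zeta>0 \<omega>})
      = (\<Sum>x\<in>?S. prob {\<omega> \<in> space M. \<zeta>0 \<omega> = x \<and> enat n < bf_return_time \<xi> \<zeta>0 \<omega>})"
    unfolding return_time_gt_init_event
  proof (rule finite_measure_finite_Union[OF finite_states_largest_active])
    show "disjoint_family_on (\<lambda>x. {\<omega> \<in> space M. \<zeta>0 \<omega> = x \<and> enat n < bf_return_time \<xi> \<zeta>0 \<omega>}) ?S"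
      unfolding disjoint_family_on_def by blast
  qed (use return_time_event_sets in blast)
  also have "\<dots> \<le> (\<Sum>x\<in>?S. prob {\<omega> \<in> space M. \<zeta>0 \<omega> = x} * B)"
  proof (rule sum_mono)
    fix x assume "x \<in> ?S"
    then have "x \<in> bf_states" "survival P n x \<le> B"
      using assms by simp_all
    then show "prob {\<omega> \<in> space M. \<zeta>0 \<omega> = x \<and> enat n < bf_return_time \<xi> \<zeta>0 \<omega>}
        \<le> prob {\<omega> \<in> space M. \<zeta>0 \<omega> = x} * B"
      unfolding prob_return_time_gt[OF \<open>x \<in> bf_states\<close>] by (intro mult_left_mono measure_nonneg)
  qed
  also have "\<dots> = (\<Sum>x\<in>?S. prob {\<omega> \<in> space M. \<zeta>0 \<omega> = x}) * B"
    by (rule sum_distrib_right[symmetric])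
  also have "(\<Sum>x\<in>?S. prob {\<omega> \<in> space M. \<zeta>0 \<omega> = x}) = prob (bf_init_event M \<zeta>0 m)"
    unfolding init_event_eq
  proof (rule finite_measure_finite_Union[OF finite_states_largest_active, symmetric])
    show "disjoint_family_on (\<lambda>x. {\<omega> \<in> space M. \<zeta>0 \<omega> = x}) ?S"
      unfolding disjoint_family_on_def by blast
  qed (use init_event_sets in blast)
  finally show ?thesis .
qed

end

context geometric_law
begin

section \<open>Tail and moments of the return time\<close>

definition scale_time :: "nat \<Rightarrow> nat" where
  "scale_time K = nat \<lceil>(1 / p) ^ K\<rceil>"

lemma scale_time_bounds:
  "(1 / p) ^ K \<le> real (scale_time K)" "real (scale_time K) \<le> 2 * (1 / p) ^ K" "1 \<le> scale_time K"
proof -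
  have 1: "1 \<le> (1 / p) ^ K"
    using p by (intro one_le_power) (simp add: field_simps)
  show lower: "(1 / p) ^ K \<le> real (scale_time K)"
    unfolding scale_time_def by linarith
  show "real (scale_time K) \<le> 2 * (1 / p) ^ K"
    unfolding scale_time_def using 1 by linarith
  show "1 \<le> scale_time K"
    using 1 lower by linarith
qed

lemma scale_time_0 [simp]: "scale_time 0 = 1"
  by (simp add: scale_time_def)

lemma scale_time_unbounded: "\<exists>K. n < scale_time K"
proof -
  obtain K where "real n < (1 / p) ^ K"
    using p real_arch_pow[of "1 / p" "real n"] by (auto simp: field_simps)
  then show ?thesis
    using scale_time_bounds(1)[of K] by (intro exI[of _ K]) linarith
qed

definition tail_const :: real where
  "tail_const = 4 * (scale_const + 1) * (1 + 2 * C)"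

lemma tail_const_pos: "0 < tail_const"
  using scale_const_pos C by (simp add: tail_const_def)

text \<open>The Tauberian bound at the time \<open>p^-K\<close>: its numerator is at most of order \<open>(2p)^-m\<close>, its denominator at
  least of order \<open>(2p)^-K\<close>.\<close>

lemma survival_scale_time_le:
  assumes x: "x \<in> bits" "\<And>k. x k \<noteq> 0 \<Longrightarrow> 1 \<le> k \<and> k \<le> m"
  shows "survival P (scale_time K) x \<le> tail_const * (1 / (2 * p)) ^ m * (2 * p) ^ K"
proof -
  define N where "N = scale_time K"
  define s where "s = 1 - 1 / (2 * real N)"
  define D where "D = (1 / (2 * p)) ^ m"
  have N: "1 \<le> N" "(1 / p) ^ K \<le> real N"
    using scale_time_bounds by (auto simp: N_def)
  have s: "1 / 2 \<le> s" "s < 1" "0 < s"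
    using N by (auto simp: s_def field_simps)
  have D: "1 \<le> D"
    unfolding D_def using p by (intro one_le_power) (simp add: field_simps)
  have "1 - s \<le> 1 / real N"
    using N by (simp add: s_def field_simps)
  also have "\<dots> \<le> 1 / (1 / p) ^ K"
    using N p by (intro frac_le) auto
  also have "\<dots> = p ^ K"
    by (simp add: power_divide)
  finally have s1: "1 - s \<le> p ^ K" .
  have pK: "0 < p ^ K" "0 < C * p ^ K"
    using p C by auto
  have "1 - s + 2 * (C * p ^ K) \<le> (1 + 2 * C) * p ^ K" "0 < 1 - s + 2 * (C * p ^ K)"
    using s s1 pK by (simp_all add: algebra_simps)
  then have "(1 / 2) ^ K / ((1 + 2 * C) * p ^ K) \<le> (1 / 2) ^ K / (1 - s + 2 * (C * p ^ K))"
    by (intro frac_le) simp_all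
  also have "\<dots> \<le> green P s ground"
    using green_ground_lower s by simp
  finally have "(1 / 2) ^ K / ((1 + 2 * C) * p ^ K) \<le> green P s ground" .
  then have lower: "1 / ((1 + 2 * C) * (2 * p) ^ K) \<le> green P s ground"
    by (simp add: power_divide power_mult_distrib mult_ac)
  have lower_pos: "0 < 1 / ((1 + 2 * C) * (2 * p) ^ K)"
    using C p by simp
  have num: "green P s ground - green P s x + of_bool (x = ground) \<le> (scale_const + 1) * D"
  proof -
    have "green P s ground - green P s x \<le> scale_const * D"
      unfolding D_def by (rule green_difference_le[OF s(1,2)]) (use x(2) in blast)
    moreover have "of_bool (x = ground) \<le> D"
      using D by simp
    ultimately show ?thesis
      unfolding distrib_right by linarith
  qed
  have "survival P N x \<le> 4 * (green P s ground - green P s x + of_bool (x = ground)) / green P s ground"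
    by (rule survival_le_green[OF N(1) x(1)]) (simp add: s_def)
  also have "\<dots> \<le> 4 * ((scale_const + 1) * D) / (1 / ((1 + 2 * C) * (2 * p) ^ K))"
    using num lower lower_pos scale_const_pos D by (intro frac_le) auto
  also have "\<dots> = tail_const * D * (2 * p) ^ K"
    by (simp add: tail_const_def)
  finally show ?thesis
    by (simp add: N_def D_def)
qed

text \<open>If \<open>t\<close> lies between the scale times \<open>K\<close> and \<open>K + 1\<close>, the term \<open>K\<close> already bounds the power; if
  \<open>t\<close> is infinite, every term is at least 1. The summand 1 covers \<open>t \<le> 1\<close>.\<close>

lemma enat_powr_le_scales:
  assumes r: "0 < r"
  shows "enat_powr t r \<le>
    1 + (\<Sum>K. ennreal ((2 * (1 / p) ^ Suc K) powr r) * indicator {t. enat (scale_time K) < t} t)"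
    (is "_ \<le> 1 + (\<Sum>K. ?f K)")
proof (cases t)
  case (enat n)
  show ?thesis
  proof (cases "n \<le> 1")
    case True
    then have "real n powr r \<le> 1"
      using r by (cases n) auto
    then have "enat_powr t r \<le> 1"
      using enat by (simp add: enat_powr_def)
    also have "\<dots> \<le> 1 + (\<Sum>K. ?f K)"
      by simp
    finally show ?thesis .
  next
    case False
    define K' where "K' = (LEAST K. n \<le> scale_time K)"
    have ex: "\<exists>K. n \<le> scale_time K"
      using scale_time_unbounded[of n] by (auto intro: less_imp_le)
    have K': "n \<le> scale_time K'"
      unfolding K'_def by (rule LeastI_ex[OF ex])
    then have "K' \<noteq> 0"
      using False by (intro notI) simp
    then obtain K where K: "K' = Suc K"
      by (cases K') auto
    have "\<not> n \<le> scale_time K"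
      using not_less_Least[of K "\<lambda>K. n \<le> scale_time K"] K by (simp add: K'_def)
    then have ind: "enat (scale_time K) < t"
      using enat by simp
    have "real n \<le> 2 * (1 / p) ^ Suc K"
      using K' scale_time_bounds(2)[of "Suc K"] unfolding K by linarith
    then have "enat_powr t r \<le> ?f K"
      using enat ind r by (simp add: enat_powr_def powr_mono2 ennreal_leI del: power_Suc)
    also have "\<dots> = sum ?f {K}"
      by (subst sum.insert) (simp_all only: finite.emptyI empty_iff sum.empty add_0_right not_False_eq_True)
    also have "\<dots> \<le> (\<Sum>K. ?f K)"
      by (rule sum_le_suminf) simp_all
    also have "\<dots> \<le> 1 + (\<Sum>K. ?f K)"
      by simp
    finally show ?thesis .
  qed
next
  case infinity
  have ge: "of_nat n \<le> (\<Sum>K. ?f K)" for n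
  proof -
    have f: "1 \<le> ?f K" for K
    proof -
      have "1 \<le> (1 / p) ^ Suc K"
        using p by (intro one_le_power) (simp add: field_simps)
      then have "1 \<le> (2 * (1 / p) ^ Suc K) powr r"
        using r by (intro ge_one_powr_ge_zero) auto
      then show ?thesis
        using infinity by (simp del: power_Suc)
    qed
    have "of_nat n = (\<Sum>K<n. 1 :: ennreal)"
      by simp
    also have "\<dots> \<le> (\<Sum>K<n. ?f K)"
      by (intro sum_mono f)
    also have "\<dots> \<le> (\<Sum>K. ?f K)"
      by (rule sum_le_suminf) auto
    finally show ?thesis .
  qed
  have "\<not> (\<Sum>K. ?f K) < \<top>"
  proof
    assume "(\<Sum>K. ?f K) < \<top>"
    then obtain n where "(\<Sum>K. ?f K) < of_nat n"
      using ennreal_Ex_less_of_nat by blast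
    then show False
      using leD[OF ge[of n]] by blast
  qed
  then have "(\<Sum>K. ?f K) = \<top>"
    unfolding less_top[symmetric] by blast
  then show ?thesis by simp
qed

definition moment_const :: "real \<Rightarrow> real" where
  "moment_const r = 1 + tail_const * (2 / p) powr r / (1 - 2 * p * (1 / p) powr r)"

lemma moment_const_pos: "2 * p * (1 / p) powr r < 1 \<Longrightarrow> 0 < moment_const r"
  using tail_const_pos by (simp add: moment_const_def add_pos_nonneg)

text \<open>The measure \<open>Q\<close> is kept abstract so that it can be a conditional probability.\<close>

lemma moment_le_of_tail:
  fixes Q :: "'z measure" and T :: "'z \<Rightarrow> enat"
  assumes r: "0 < r" "2 * p * (1 / p) powr r < 1"
    and Q: "emeasure Q (space Q) = 1"
    and sets: "\<And>n. {\<omega> \<in> space Q. enat n < T \<omega>} \<in> sets Q"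
    and D: "1 \<le> D"
    and tail: "\<And>K. emeasure Q {\<omega> \<in> space Q. enat (scale_time K) < T \<omega>} \<le> ennreal (tail_const * D * (2 * p) ^ K)"
  shows "(\<integral>\<^sup>+ \<omega>. enat_powr (T \<omega>) r \<partial>Q) \<le> ennreal (moment_const r * D)"
proof -
  let ?A = "\<lambda>K. {\<omega> \<in> space Q. enat (scale_time K) < T \<omega>}"
  let ?c = "\<lambda>K. (2 * (1 / p) ^ Suc K) powr r"
  define q where "q = 2 * p * (1 / p) powr r"
  have q: "0 < q" "q < 1"
    using p r by (auto simp: q_def)
  have c: "?c K * (tail_const * D * (2 * p) ^ K) = tail_const * (2 / p) powr r * D * q ^ K" for K
  proof -
    have "?c K = (2 / p) powr r * ((1 / p) powr r) ^ K"
      using p by (simp add: powr_mult powr_power powr_realpow[symmetric] powr_powr powr_divide mult_ac)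
    then show ?thesis
      by (simp add: q_def power_mult_distrib)
  qed
  have "(\<integral>\<^sup>+ \<omega>. enat_powr (T \<omega>) r \<partial>Q) \<le> (\<integral>\<^sup>+ \<omega>. 1 + (\<Sum>K. ennreal (?c K) * indicator (?A K) \<omega>) \<partial>Q)"
  proof (rule nn_integral_mono)
    fix \<omega> assume "\<omega> \<in> space Q"
    then have "indicator {t. enat (scale_time K) < t} (T \<omega>) = (indicator (?A K) \<omega> :: ennreal)" for K
      by (simp add: indicator_def)
    then show "enat_powr (T \<omega>) r \<le> 1 + (\<Sum>K. ennreal (?c K) * indicator (?A K) \<omega>)"
      using enat_powr_le_scales[OF r(1), of "T \<omega>"] by simp
  qed
  also have "\<dots> = 1 + (\<Sum>K. ennreal (?c K) * emeasure Q (?A K))"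
  proof -
    have m: "(\<lambda>\<omega>. ennreal (?c K) * indicator (?A K) \<omega>) \<in> borel_measurable Q" for K
      by (intro borel_measurable_times_ennreal borel_measurable_const borel_measurable_indicator sets)
    have "(\<integral>\<^sup>+ \<omega>. 1 + (\<Sum>K. ennreal (?c K) * indicator (?A K) \<omega>) \<partial>Q)
        = (\<integral>\<^sup>+ \<omega>. 1 \<partial>Q) + (\<integral>\<^sup>+ \<omega>. (\<Sum>K. ennreal (?c K) * indicator (?A K) \<omega>) \<partial>Q)"
      by (intro nn_integral_add borel_measurable_const borel_measurable_suminf_order m)
    also have "(\<integral>\<^sup>+ \<omega>. (\<Sum>K. ennreal (?c K) * indicator (?A K) \<omega>) \<partial>Q)
        = (\<Sum>K. (\<integral>\<^sup>+ \<omega>. ennreal (?c K) * indicator (?A K) \<omega> \<partial>Q))"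
      by (rule nn_integral_suminf[OF m])
    finally show ?thesis
      unfolding nn_integral_cmult_indicator[OF sets] nn_integral_const Q by (simp only: mult_1)
  qed
  also have "\<dots> \<le> 1 + (\<Sum>K. ennreal (tail_const * (2 / p) powr r * D * q ^ K))"
  proof (intro add_left_mono suminf_le)
    fix K
    have "ennreal (?c K) * emeasure Q (?A K) \<le> ennreal (?c K) * ennreal (tail_const * D * (2 * p) ^ K)"
      by (intro mult_left_mono tail) simp
    also have "\<dots> = ennreal (tail_const * (2 / p) powr r * D * q ^ K)"
      using D p tail_const_pos by (subst ennreal_mult[symmetric]) (simp_all only: c, simp_all)
    finally show "ennreal (?c K) * emeasure Q (?A K) \<le> ennreal (tail_const * (2 / p) powr r * D * q ^ K)" .
  qed simp_all
  also have "(\<Sum>K. ennreal (tail_const * (2 / p) powr r * D * q ^ K))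
      = ennreal (tail_const * (2 / p) powr r * D * (1 / (1 - q)))"
    using q D tail_const_pos
    by (intro suminf_ennreal_eq sums_mult geometric_sums) simp_all
  also have "1 + \<dots> = ennreal (1 + tail_const * (2 / p) powr r * D * (1 / (1 - q)))"
    using q D tail_const_pos by (subst ennreal_plus) simp_all
  also have "\<dots> \<le> ennreal (moment_const r * D)"
  proof (rule ennreal_leI)
    have "moment_const r = 1 + tail_const * (2 / p) powr r / (1 - q)"
      by (simp only: moment_const_def q_def)
    then show "1 + tail_const * (2 / p) powr r * D * (1 / (1 - q)) \<le> moment_const r * D"
      using D by (simp add: algebra_simps)
  qed
  finally show ?thesis .
qed

lemma moment_given_init_le:
  assumes model: "bf_model N P \<xi> \<zeta>0"
    and r: "0 < r" "2 * p * (1 / p) powr r < 1"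
    and pos: "0 < measure N (bf_init_event N \<zeta>0 m)"
  shows "bf_moment (uniform_measure N (bf_init_event N \<zeta>0 m)) \<xi> \<zeta>0 r
    \<le> ennreal (moment_const r * (1 / (2 * p)) ^ m)"
  unfolding bf_moment_def
proof (rule moment_le_of_tail[OF r])
  interpret bf_model N P \<xi> \<zeta>0 by (rule model)
  let ?E = "bf_init_event N \<zeta>0 m"
  let ?A = "\<lambda>n. {\<omega> \<in> space N. enat n < bf_return_time \<xi> \<zeta>0 \<omega>}"
  have A: "?A n \<in> sets N" for n
    by (rule return_time_gt_sets)
  have E: "?E \<in> sets N" by (rule bf_init_event_sets)
  have emE: "emeasure N ?E = ennreal (prob ?E)" by (rule emeasure_eq_measure)
  show "emeasure (uniform_measure N ?E) (space (uniform_measure N ?E)) = 1"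
    using E pos emE by simp
  show "{\<omega> \<in> space (uniform_measure N ?E). enat n < bf_return_time \<xi> \<zeta>0 \<omega>}
      \<in> sets (uniform_measure N ?E)" for n
    unfolding space_uniform_measure sets_uniform_measure by (rule A)
  show "1 \<le> (1 / (2 * p)) ^ m"
    using p by (intro one_le_power) (simp add: field_simps)
  show "emeasure (uniform_measure N ?E) {\<omega> \<in> space (uniform_measure N ?E). enat (scale_time K) < bf_return_time \<xi> \<zeta>0 \<omega>}
      \<le> ennreal (tail_const * (1 / (2 * p)) ^ m * (2 * p) ^ K)" for K
  proof -
    let ?B = "tail_const * (1 / (2 * p)) ^ m * (2 * p) ^ K"
    have "emeasure (uniform_measure N ?E) (?A (scale_time K)) = emeasure N (?E \<inter> ?A (scale_time K)) / emeasure N ?E"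
      by (rule emeasure_uniform_measure[OF E A])
    also have "\<dots> = ennreal (prob (?E \<inter> ?A (scale_time K)) / prob ?E)"
      unfolding emeasure_eq_measure using pos by (intro divide_ennreal) simp_all
    also have "\<dots> \<le> ennreal ?B"
    proof (rule ennreal_leI)
      have "prob (?E \<inter> ?A (scale_time K)) \<le> prob ?E * ?B"
      proof (rule prob_return_time_gt_init_event_le)
        fix x assume "x \<in> bf_states" "largest_active x = m"
        then show "survival P (scale_time K) x \<le> ?B"
          using active_le_largest_active by (intro survival_scale_time_le) (auto intro: bf_states_bits)
      qed
      then show "prob (?E \<inter> ?A (scale_time K)) / prob ?E \<le> ?B"
        using pos by (simp add: divide_le_eq mult.commute)
    qed
    finally show ?thesis
      unfolding space_uniform_measure .
  qed
qed

text \<open>The left side is at most \<open>min t (2N)\<close>, and \<open>min t u \<le> u powr (1 - r') * t powr r'\<close> for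
  exponents \<open>r'\<close> in the unit interval.\<close>

lemma geometric_sum_le_powr:
  fixes t :: enat and N L :: nat
  assumes N: "1 \<le> N" and s: "s = 1 - 1 / (2 * real N)" and t: "1 \<le> t"
    and r: "0 < r'" "r' \<le> 1" "r' \<le> r"
  shows "(\<Sum>n<L. ennreal (s ^ n) * indicator {t. enat n < t} t) \<le> ennreal ((2 * real N) powr (1 - r')) * enat_powr t r"
proof (cases t)
  case infinity
  then show ?thesis
    using N by (simp add: enat_powr_def ennreal_mult_top)
next
  case (enat k)
  have k: "1 \<le> k"
    using t enat by (simp add: one_enat_def)
  have s01: "0 < s" "s < 1" "1 / (1 - s) = 2 * real N"
    using N by (auto simp: s field_simps)
  have "(\<Sum>n<L. ennreal (s ^ n) * indicator {t. enat n < t} t) = (\<Sum>n<L. ennreal (s ^ n * of_bool (n < k)))"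
    using enat by (intro sum.cong refl) (simp add: indicator_def)
  also have "\<dots> = ennreal (\<Sum>n<L. s ^ n * of_bool (n < k))"
    using s01 by (intro sum_ennreal) simp
  also have "\<dots> \<le> ennreal ((2 * real N) powr (1 - r') * real k powr r)"
  proof (rule ennreal_leI)
    let ?S = "\<Sum>n<L. s ^ n * of_bool (n < k)"
    have S: "?S \<le> (\<Sum>n<k. s ^ n)"
    proof -
      have "?S = (\<Sum>n<L. if n \<in> {..<k} then s ^ n else 0)"
        by (intro sum.cong) simp_all
      also have "\<dots> = (\<Sum>n\<in>{..<L} \<inter> {..<k}. s ^ n)"
        by (rule sum.inter_restrict[symmetric]) simp
      also have "\<dots> \<le> (\<Sum>n<k. s ^ n)"
        using s01 by (intro sum_mono2) auto
      finally show ?thesis .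
    qed
    have "(\<Sum>n<k. s ^ n) \<le> (\<Sum>n<k. 1)"
      using s01 by (intro sum_mono power_le_one) auto
    then have S1: "?S \<le> real k"
      using S by simp
    have "(\<Sum>n<k. s ^ n) = (1 - s ^ k) / (1 - s)"
      using s01(2) by (subst sum_gp_strict) simp
    also have "\<dots> \<le> 1 / (1 - s)"
      using s01 by (intro divide_right_mono) auto
    finally have S2: "?S \<le> 2 * real N"
      unfolding s01(3) using S by linarith
    have "?S \<le> (2 * real N) powr (1 - r') * real k powr r'"
    proof (cases "real k \<le> 2 * real N")
      case True
      have "real k = real k powr (1 - r') * real k powr r'"
        using k by (simp add: powr_add[symmetric])
      also have "\<dots> \<le> (2 * real N) powr (1 - r') * real k powr r'"
        using True r by (intro mult_right_mono powr_mono2) auto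
      finally show ?thesis using S1 by linarith
    next
      case False
      have "2 * real N = (2 * real N) powr (1 - r') * (2 * real N) powr r'"
        using N by (simp add: powr_add[symmetric])
      also have "\<dots> \<le> (2 * real N) powr (1 - r') * real k powr r'"
        using False r by (intro mult_left_mono powr_mono2) auto
      finally show ?thesis using S2 by linarith
    qed
    also have "\<dots> \<le> (2 * real N) powr (1 - r') * real k powr r"
      using k r by (intro mult_left_mono powr_mono) auto
    finally show "?S \<le> (2 * real N) powr (1 - r') * real k powr r" .
  qed
  also have "\<dots> = ennreal ((2 * real N) powr (1 - r')) * enat_powr t r"
    using enat by (simp add: enat_powr_def ennreal_mult)
  finally show ?thesis .
qed

text \<open>Taking expectations in the previous estimate bounds every partial sum of the survival generating
  function at the ground state, hence its resolvent, which is \<open>2N / green P s ground\<close>.\<close>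

lemma powr_le_green_of_finite_moment:
  assumes model: "bf_model M P \<xi> (\<lambda>_. ground)"
    and r: "0 < r'" "r' \<le> 1" "r' \<le> r"
    and fin: "bf_moment M \<xi> (\<lambda>_. ground) r = ennreal B" "0 \<le> B"
    and N: "1 \<le> N" and s: "s = 1 - 1 / (2 * real N)"
  shows "(2 * real N) powr r' \<le> B * green P s ground"
proof -
  interpret bf_model M P \<xi> "\<lambda>_. ground" by (rule model)
  let ?T = "bf_return_time \<xi> (\<lambda>_. ground)"
  let ?A = "\<lambda>n. {\<omega> \<in> space M. enat n < ?T \<omega>}"
  let ?c = "(2 * real N) powr (1 - r')"
  have s01: "0 < s" "s < 1"
    using N by (auto simp: s field_simps)
  have c: "0 < ?c"
    using N by simp
  have T: "1 \<le> ?T \<omega>" for \<omega>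
  proof -
    have "enat 0 < ?T \<omega>"
      unfolding return_time_gt_iff by (simp add: driving_path_def)
    then show ?thesis
      by (simp add: one_enat_def enat_0 ileI1 eSuc_enat[symmetric] flip: Suc_ile_eq)
  qed
  have ground_state: "ground \<in> bf_states"
    by (simp add: bf_states_def ground_def)
  have A: "emeasure M (?A n) = ennreal (survival P n ground)" for n
    using prob_return_time_gt[OF ground_state, of n] by (simp add: emeasure_eq_measure prob_space)
  have sum_le: "(\<Sum>n<L. s ^ n * survival P n ground) \<le> ?c * B" for L
  proof -
    have "ennreal (\<Sum>n<L. s ^ n * survival P n ground) = (\<Sum>n<L. ennreal (s ^ n) * emeasure M (?A n))"
      using s01 by (simp add: A sum_ennreal[symmetric] ennreal_mult)
    also have "\<dots> = (\<Sum>n<L. \<integral>\<^sup>+ \<omega>. ennreal (s ^ n) * indicator (?A n) \<omega> \<partial>M)"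
      unfolding nn_integral_cmult_indicator[OF return_time_gt_sets] ..
    also have "\<dots> = (\<integral>\<^sup>+ \<omega>. (\<Sum>n<L. ennreal (s ^ n) * indicator (?A n) \<omega>) \<partial>M)"
      by (intro nn_integral_sum[symmetric] borel_measurable_times_ennreal borel_measurable_const
          borel_measurable_indicator return_time_gt_sets)
    \<comment> \<open>The constant moves to the side of the finite sum, since measurability is known only there.\<close>
    also have "\<dots> = (\<integral>\<^sup>+ \<omega>. ennreal ?c * (ennreal (1 / ?c) * (\<Sum>n<L. ennreal (s ^ n) * indicator (?A n) \<omega>)) \<partial>M)"
      using c by (simp add: mult.assoc[symmetric] ennreal_mult[symmetric])
    also have "\<dots> = ennreal ?c * (\<integral>\<^sup>+ \<omega>. ennreal (1 / ?c) * (\<Sum>n<L. ennreal (s ^ n) * indicator (?A n) \<omega>) \<partial>M)"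
      by (intro nn_integral_cmult borel_measurable_times_ennreal borel_measurable_const borel_measurable_sum
          borel_measurable_indicator return_time_gt_sets)
    also have "\<dots> \<le> ennreal ?c * (\<integral>\<^sup>+ \<omega>. enat_powr (?T \<omega>) r \<partial>M)"
    proof (intro mult_left_mono nn_integral_mono)
      fix \<omega> assume w: "\<omega> \<in> space M"
      have "(\<Sum>n<L. ennreal (s ^ n) * indicator (?A n) \<omega>)
          = (\<Sum>n<L. ennreal (s ^ n) * indicator {t. enat n < t} (?T \<omega>))"
        using w by (intro sum.cong refl) (simp add: indicator_def)
      also have "\<dots> \<le> ennreal ?c * enat_powr (?T \<omega>) r"
        by (rule geometric_sum_le_powr[OF N s T r])
      finally have "ennreal (1 / ?c) * (\<Sum>n<L. ennreal (s ^ n) * indicator (?A n) \<omega>)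
          \<le> ennreal (1 / ?c) * (ennreal ?c * enat_powr (?T \<omega>) r)"
        by (intro mult_left_mono) simp_all
      also have "\<dots> = enat_powr (?T \<omega>) r"
        using c by (simp add: mult.assoc[symmetric] ennreal_mult[symmetric])
      finally show "ennreal (1 / ?c) * (\<Sum>n<L. ennreal (s ^ n) * indicator (?A n) \<omega>) \<le> enat_powr (?T \<omega>) r" .
    qed simp
    also have "\<dots> = ennreal (?c * B)"
      using fin c unfolding bf_moment_def by (simp add: ennreal_mult)
    finally show ?thesis
      using c fin by (subst (asm) ennreal_le_iff) simp_all
  qed
  have "resolvent P s ground \<le> ?c * B + s ^ L * (2 / (1 - s))" for L
    using survival_gf_bounds(2)[OF s01 ground_bits, of P L] sum_le[of L] by linarith
  moreover have "(\<lambda>L. ?c * B + s ^ L * (2 / (1 - s))) \<longlonglongrightarrow> ?c * B + 0 * (2 / (1 - s))"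
    using s01 by (intro tendsto_intros LIMSEQ_power_zero) simp
  ultimately have "resolvent P s ground \<le> ?c * B + 0 * (2 / (1 - s))"
    by (intro LIMSEQ_le_const[of _ _ "resolvent P s ground"]) auto
  moreover have "resolvent P s ground = 2 * real N / green P s ground"
    using N by (simp add: resolvent_def s)
  moreover have g: "0 < green P s ground"
    using green_ground_ge_half[OF s01, of P] by linarith
  ultimately have "2 * real N \<le> ?c * B * green P s ground"
    by (simp add: divide_le_eq)
  moreover have "2 * real N = ?c * (2 * real N) powr r'"
    using N by (simp add: powr_add[symmetric])
  ultimately have "?c * (2 * real N) powr r' \<le> ?c * (B * green P s ground)"
    by (simp add: mult.assoc)
  then show ?thesis
    using c by (subst (asm) mult_le_cancel_left_pos)
qed

text \<open>For \<open>N\<close> of order \<open>p^-K\<close> the previous lemma gives \<open>p^(-K r) \<le> B G\<close> with \<open>G\<close> of order \<open>(2p)^-K\<close>, so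
  that the powers of \<open>2p (1/p)^r\<close> would remain bounded. Exponents above 1 are first lowered to 1,
  where this ratio is 2.\<close>

lemma moment_infinite:
  assumes model: "bf_model M P \<xi> (\<lambda>_. ground)"
    and r: "0 < r" "1 < 2 * p * (1 / p) powr r"
  shows "bf_moment M \<xi> (\<lambda>_. ground) r = \<infinity>"
proof (rule ccontr)
  assume "bf_moment M \<xi> (\<lambda>_. ground) r \<noteq> \<infinity>"
  then obtain B where B: "bf_moment M \<xi> (\<lambda>_. ground) r = ennreal B" "0 \<le> B"
    by (cases "bf_moment M \<xi> (\<lambda>_. ground) r") auto
  define r' where "r' = min r 1"
  have r': "0 < r'" "r' \<le> 1" "r' \<le> r"
    using r by (auto simp: r'_def)
  define b where "b = 2 * p * (1 / p) powr r'"
  have b: "1 < b"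
    using r p by (auto simp: b_def r'_def min_def)
  have "b ^ K \<le> B * (scale_const + 4)" for K
  proof -
    define N where "N = scale_time K"
    define s where "s = 1 - 1 / (2 * real N)"
    have N: "(1 / p) ^ K \<le> real N" "real N \<le> 2 * (1 / p) ^ K" "1 \<le> N"
      using scale_time_bounds by (auto simp: N_def)
    have s: "1 / 2 \<le> s" "s < 1" "1 / (1 - s) = 2 * real N"
      using N(3) by (auto simp: s_def field_simps)
    have "green P s ground \<le> scale_const * (1 / (2 * p)) ^ K + (1 / 2) ^ K / (1 - s)"
      by (rule green_ground_upper[OF s(1,2)])
    also have "(1 / 2) ^ K / (1 - s) = (1 / 2) ^ K * (2 * real N)"
      unfolding s(3)[symmetric] by simp
    also have "\<dots> \<le> (1 / 2) ^ K * (2 * (2 * (1 / p) ^ K))"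
      using N by (intro mult_left_mono) simp_all
    also have "\<dots> = 4 * (1 / (2 * p)) ^ K"
      by (simp add: power_divide power_mult_distrib)
    finally have green: "green P s ground \<le> (scale_const + 4) * (1 / (2 * p)) ^ K"
      by (simp add: distrib_right)
    have "((1 / p) powr r') ^ K = ((1 / p) ^ K) powr r'"
      using p by (simp add: powr_power powr_realpow[symmetric] powr_powr mult.commute)
    also have "\<dots> \<le> (2 * real N) powr r'"
      using N p r' by (intro powr_mono2) auto
    also have "\<dots> \<le> B * green P s ground"
      by (rule powr_le_green_of_finite_moment[OF model r' B N(3) s_def])
    also have "\<dots> \<le> B * ((scale_const + 4) * (1 / (2 * p)) ^ K)"
      using B green by (intro mult_left_mono)
    finally have "(2 * p) ^ K * ((1 / p) powr r') ^ K \<le> (2 * p) ^ K * (B * ((scale_const + 4) * (1 / (2 * p)) ^ K))"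
      using p by (intro mult_left_mono) simp_all
    also have "\<dots> = B * (scale_const + 4)"
      using p by (simp add: power_divide)
    finally show ?thesis
      by (simp only: b_def power_mult_distrib)
  qed
  moreover obtain K where "B * (scale_const + 4) < b ^ K"
    using real_arch_pow[OF b] by blast
  ultimately show False
    using leD by blast
qed

end

section \<open>The moment theorem\<close>

text \<open>The asymptotics bound the ratio \<open>pmf P k / p ^ k\<close> for large \<open>k\<close>. For the finitely many other bits it
  is positive, since an unbounded support and monotonicity force every bit to have positive mass.\<close>

lemma geometric_law_of_asymp:
  fixes P :: "nat pmf" and C1 p :: real
  assumes P0: "pmf P 0 = 0"
    and anti: "\<And>k. k \<ge> 1 \<Longrightarrow> pmf P (Suc k) \<le> pmf P k"
    and inf: "infinite (set_pmf P)"
    and C1: "C1 > 0" and p: "0 < p" "p < 1/2"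
    and asymp: "(\<lambda>k. pmf P k) \<sim>[at_top] (\<lambda>k. C1 * p ^ k)"
  obtains c C where "geometric_law P p c C"
proof -
  define \<rho> where "\<rho> k = pmf P k / p ^ k" for k
  have pos: "0 < \<rho> k" if k: "1 \<le> k" for k
  proof -
    obtain j where j: "k \<le> j" "j \<in> set_pmf P"
      using inf unfolding infinite_nat_iff_unbounded_le by blast
    have "pmf P j \<le> pmf P k"
      using j(1)
    proof (induction rule: dec_induct)
      case (step n)
      then show ?case using anti[of n] k by linarith
    qed simp
    moreover have "0 < pmf P j"
      using j(2) by (simp add: pmf_positive)
    ultimately show ?thesis
      using p by (simp add: \<rho>_def)
  qed
  have "((\<lambda>k. pmf P k / (C1 * p ^ k)) \<longlongrightarrow> 1) at_top"
    using asymp_equivD[OF asymp] C1 p by simp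
  then have "((\<lambda>k. C1 * (pmf P k / (C1 * p ^ k))) \<longlongrightarrow> C1 * 1) at_top"
    by (intro tendsto_intros)
  then have lim: "(\<rho> \<longlongrightarrow> C1) at_top"
    using C1 by (simp add: \<rho>_def[abs_def])
  have "eventually (\<lambda>k. C1 / 2 < \<rho> k \<and> \<rho> k < 2 * C1) at_top"
    using order_tendstoD(1)[OF lim, of "C1 / 2"] order_tendstoD(2)[OF lim, of "2 * C1"] C1
    by (intro eventually_conj) auto
  then obtain K where K: "\<And>k. K \<le> k \<Longrightarrow> C1 / 2 < \<rho> k \<and> \<rho> k < 2 * C1"
    unfolding eventually_at_top_linorder by blast
  define c where "c = Min (insert (C1 / 2) (\<rho> ` {1..K}))"
  define C where "C = Max (insert (2 * C1) (\<rho> ` {1..K}))"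
  have "0 < c"
    unfolding c_def using C1 pos by (subst Min_gr_iff) auto
  have "2 * C1 \<le> C"
    unfolding C_def by (rule Max_ge) auto
  have "c \<le> C1 / 2"
    unfolding c_def by (rule Min_le) auto
  have bounds: "c \<le> \<rho> k \<and> \<rho> k \<le> C" if "1 \<le> k" for k
  proof (cases "k \<le> K")
    case True
    then have "\<rho> k \<in> \<rho> ` {1..K}"
      using that by (intro imageI) simp
    then show ?thesis
      unfolding c_def C_def by (intro conjI Min_le Max_ge finite.insertI finite_imageI insertI2) simp_all
  next
    case False
    then show ?thesis
      using K[of k] \<open>2 * C1 \<le> C\<close> \<open>c \<le> C1 / 2\<close> by auto
  qed
  have "geometric_law P p c C"
  proof
    fix k :: nat assume "1 \<le> k"
    from bounds[OF this] show "c * p ^ k \<le> pmf P k" "pmf P k \<le> C * p ^ k"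
      using p by (simp_all add: \<rho>_def field_simps)
  qed (use p P0 \<open>0 < c\<close> \<open>2 * C1 \<le> C\<close> C1 in auto)
  then show thesis by (rule that)
qed

lemma (in prob_space) uniform_measure_space: "uniform_measure M (space M) = M"
proof (rule measure_eqI)
  fix A assume "A \<in> sets (uniform_measure M (space M))"
  then have A: "A \<in> events" by simp
  then have "space M \<inter> A = A"
    by (rule sets.Int_space_eq1)
  then show "emeasure (uniform_measure M (space M)) A = emeasure M A"
    by (simp add: emeasure_uniform_measure[OF sets.top A] emeasure_space_1 divide_ennreal_def)
qed simp

text \<open>The ratio between consecutive scales is below 1 for \<open>ln 2 < (1 - r) ln (1/p)\<close> and above 1 for the
  opposite strict inequality.\<close>

lemma scale_factor_eq_exp:
  fixes p r :: real
  assumes "0 < p"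
  shows "2 * p * (1 / p) powr r = exp (ln 2 - (1 - r) * ln (1 / p))"
  using assms by (simp add: powr_def exp_diff exp_add exp_minus ln_div left_diff_distrib divide_inverse)

theorem theorem2p3:
  fixes P :: "nat pmf" and C1 p :: real
    and M :: "'a measure" and \<xi> :: "nat \<Rightarrow> 'a \<Rightarrow> nat"
  assumes "pmf P 0 = 0"
    and "\<And>k. k \<ge> 1 \<Longrightarrow> pmf P (Suc k) \<le> pmf P k"
    and "infinite (set_pmf P)"
    and "C1 > 0" and "0 < p" and "p < 1/2"
    and "(\<lambda>k. pmf P k) \<sim>[at_top] (\<lambda>k. C1 * p ^ k)"
    and "bf_model M P \<xi> (\<lambda>_. ground)"
    and "bf_recurrent M \<xi>"
  shows "(\<forall>r. 0 < r \<and> r < 1 - ln 2 / ln (1/p) \<longrightarrow>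
      bf_moment M \<xi> (\<lambda>_. ground) r < \<infinity> \<and>
      (\<exists>C2>0. \<forall>(N :: 'b measure) \<xi>' \<zeta>0. bf_model N P \<xi>' \<zeta>0 \<longrightarrow>
        (\<forall>m. measure N (bf_init_event N \<zeta>0 m) > 0 \<longrightarrow>
          bf_moment (uniform_measure N (bf_init_event N \<zeta>0 m)) \<xi>' \<zeta>0 r
            \<le> ennreal (C2 * (1 / (2 * p)) ^ m))))
    \<and> (\<forall>r. r > 1 - ln (2 - p) / ln (1/p) \<longrightarrow> bf_moment M \<xi> (\<lambda>_. ground) r = \<infinity>)"
proof -
  obtain c C where law: "geometric_law P p c C"
    using geometric_law_of_asymp[OF assms(1-7)] by blast
  interpret geometric_law P p c C by (rule law)
  interpret bf_model M P \<xi> "\<lambda>_. ground" by (rule assms(8))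
  have L: "0 < ln (1 / p)"
    using p by simp
  show ?thesis
  proof (intro conjI allI impI)
    fix r assume r: "0 < r \<and> r < 1 - ln 2 / ln (1/p)"
    have "ln 2 < (1 - r) * ln (1 / p)"
      using r L by (simp add: field_simps)
    then have q: "2 * p * (1 / p) powr r < 1"
      unfolding scale_factor_eq_exp[OF p(1)] by simp
    \<comment> \<open>A chain started at the ground state is the case \<open>m = 0\<close>, where the conditioning is void.\<close>
    have "bf_init_event M (\<lambda>_. ground) 0 = space M"
      by (simp add: bf_init_event_def largest_active_def)
    then have "bf_moment M \<xi> (\<lambda>_. ground) r \<le> ennreal (moment_const r * (1 / (2 * p)) ^ 0)"
      using moment_given_init_le[OF assms(8) _ q, of 0] r by (simp add: uniform_measure_space prob_space)
    also have "\<dots> < \<infinity>"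
      by simp
    finally show "bf_moment M \<xi> (\<lambda>_. ground) r < \<infinity>" .
    show "\<exists>C2>0. \<forall>(N :: 'b measure) \<xi>' \<zeta>0. bf_model N P \<xi>' \<zeta>0 \<longrightarrow>
        (\<forall>m. measure N (bf_init_event N \<zeta>0 m) > 0 \<longrightarrow>
          bf_moment (uniform_measure N (bf_init_event N \<zeta>0 m)) \<xi>' \<zeta>0 r
            \<le> ennreal (C2 * (1 / (2 * p)) ^ m))"
      using moment_given_init_le[OF _ _ q] moment_const_pos[OF q] r
      by (intro exI[of _ "moment_const r"]) blast
  next
    fix r assume r: "r > 1 - ln (2 - p) / ln (1/p)"
    have "(1 - r) * ln (1 / p) < ln (2 - p)"
      using r L by (simp add: field_simps)
    moreover have "ln (2 - p) < ln 2"
      using p by simp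
    ultimately have q: "1 < 2 * p * (1 / p) powr r"
      unfolding scale_factor_eq_exp[OF p(1)] by simp
    \<comment> \<open>\<open>p (2 - p) < 1\<close>, so the exponent in the second claim is positive.\<close>
    have "0 < (1 - p)\<^sup>2"
      using p by simp
    then have "2 - p < 1 / p"
      using p by (simp add: field_simps power2_eq_square)
    then have "ln (2 - p) < ln (1 / p)"
      using p by (subst ln_less_cancel_iff) auto
    then have "0 < r"
      using r L by (smt (verit) divide_less_eq_1_pos)
    then show "bf_moment M \<xi> (\<lambda>_. ground) r = \<infinity>"
      by (rule moment_infinite[OF assms(8) _ q])
  qed
qed

end
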